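(* Let $A\in\mathbb{R}^{n\times d}$ be a matrix of rank $t$ with $\|A\|_2\le 1$, and let $k$ be an integer with $2\le k\le t-1$. Let $\lambda_i$ be the $i$-th largest eigenvalue of $A^TA$, and assume $\lambda_1>\lambda_k$. Then there exist a $k$-subset $\widehat S\subset[n]$ and a $k$-subset $\widehat W\subset[d]$ such that $A_{\widehat S,\widehat W}$ is invertible and $$\big\|A-A_{:,\widehat W}(A_{\widehat S,\widehat W})^{-1}A_{\widehat S,:}\big\|_2^2\ \le\ \frac{(t-k+1)\,t}{(1-\sqrt{\alpha_k})^2}\cdot\|A-A_k\|_2^2,$$ where $A_k\in\mathbb{R}^{n\times d}$ is the best rank-$k$ approximation to $A$, and $\alpha_k\in(0,1)$ is defined by $$\alpha_k=\frac{\frac{1}{\lambda_{k+1}}-\frac1k\sum_{i=1}^k\frac1{\lambda_i}}{\frac1{\lambda_{k+1}}-1}.$$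
   Context: Notation: $[m]=\{1,\dots,m\}$; a $k$-subset is a subset with $k$ elements. For a matrix $M$, $M_{S,W}$ is the submatrix with rows indexed by $S$ and columns indexed by $W$; $M_{:,W}$ keeps all rows and $M_{S,:}$ keeps all columns. $\|\cdot\|_2$ is the spectral norm. *)

theory Defs
  imports
    "HOL-Analysis.L2_Norm"
    "Jordan_Normal_Form.Char_Poly"
    "Jordan_Normal_Form.DL_Rank"
    "Jordan_Normal_Form.DL_Submatrix"
    "Jordan_Normal_Form.Gauss_Jordan_Elimination"
begin

definition vec_norm2 :: "real vec \<Rightarrow> real" where
  "vec_norm2 v = L2_set (\<lambda>i. v $ i) {..<dim_vec v}"

definition spectral_norm :: "real mat \<Rightarrow> real" where
  "spectral_norm A =
     (SUP v \<in> {v \<in> carrier_vec (dim_col A). vec_norm2 v \<le> 1}. vec_norm2 (A *\<^sub>v v))"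

text \<open>Eigenvalues are counted with multiplicity and the index \<open>i\<close> is 1-based:
  \<open>i\<close> ranges over \<open>1, \<dots>, m\<close> when \<open>M\<close> is a symmetric matrix of size \<open>m\<close>.\<close>
definition nth_largest_eigenvalue :: "real mat \<Rightarrow> nat \<Rightarrow> real" where
  "nth_largest_eigenvalue M i = rev (sorted_list_of_multiset (proots (char_poly M))) ! (i - 1)"

text \<open>A minimizer need not be unique. The truncated singular value decompositions
  (the minimizers for the Frobenius norm) are among the minimizers for the spectral norm.\<close>
definition best_rank_approx :: "nat \<Rightarrow> real mat \<Rightarrow> real mat \<Rightarrow> bool" where
  "best_rank_approx k A B \<longleftrightarrow>
     B \<in> carrier_mat (dim_row A) (dim_col A) \<and>
     vec_space.rank (dim_row A) B \<le> k \<and>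
     (\<forall>C \<in> carrier_mat (dim_row A) (dim_col A). vec_space.rank (dim_row A) C \<le> k \<longrightarrow>
        spectral_norm (A - B) \<le> spectral_norm (A - C))"

end

theory Submission
  imports Defs "HOL-Analysis.Convex" "Jordan_Normal_Form.DL_Rank_Submatrix"
begin

text \<open>
  The rows \<open>S\<close> and the columns \<open>W\<close> come from an averaging argument over all \<open>k \<times> k\<close> minors,
  each pair \<open>(S, W)\<close> being weighted by its squared minor. The Schur complement formula says that
  the residual \<open>E = A - C X\<inverse> R\<close> of the cross approximation on \<open>(S, W)\<close> has the entries
  \<open>E\<^sub>r\<^sub>c = det A[S + r, W + c] / det A[S, W]\<close> (lemma \<open>minor_bordered\<close>). So the weighted sum
  of the squared Frobenius norms of all residuals is the sum of the squares of all bordered minors,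
  and some pair with a nonzero minor has a squared residual of at most \<open>P\<^sub>k\<^sub>+\<^sub>1 / P\<^sub>k\<close>
  (lemma \<open>exists_cross_approximation\<close>); here \<open>P\<^sub>k\<close> is the sum of the squared minors along all
  pairs of \<open>k\<close>-tuples of indices, repetitions allowed.

  The sums \<open>P\<^sub>k\<close> depend only on the singular values. By the Cauchy--Binet argument, summing
  squared minors over the rows gives a principal minor of \<open>A\<^sup>T A\<close>, and summing over the columns
  gives a principal minor of \<open>A A\<^sup>T\<close>. The latter matrix does not change when \<open>A\<close> is
  replaced by \<open>A U\<close> with \<open>U\<close> orthogonal. With an orthonormal eigenbasis of \<open>A\<^sup>T A\<close> as
  \<open>U\<close>, the first matrix becomes diagonal, and \<open>P\<^sub>k\<close> is \<open>(k!)\<^sup>2\<close> times the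
  elementary symmetric polynomial \<open>e\<^sub>k\<close> of the eigenvalues.

  Write \<open>\<mu> = \<lambda>\<^sub>k\<^sub>+\<^sub>1\<close>, \<open>x\<^sub>i = \<mu> / \<lambda>\<^sub>i\<close> and \<open>s = x\<^sub>1 + \<dots> + x\<^sub>k\<close>. A set \<open>T\<close> of
  \<open>k + 1\<close> indices satisfies \<open>1 + s \<le> \<Sum>\<^sub>i\<^sub>\<in>\<^sub>T x\<^sub>i\<close>, because \<open>x\<^sub>i \<le> 1\<close> for the first \<open>k\<close>
  indices and \<open>x\<^sub>i \<ge> 1\<close> for the others. Multiplying by \<open>\<Prod>\<^sub>i\<^sub>\<in>\<^sub>T \<lambda>\<^sub>i\<close> and summing over
  \<open>T\<close> gives \<open>(1 + s) e\<^sub>k\<^sub>+\<^sub>1 \<le> (t - k) \<mu> e\<^sub>k\<close> (lemma \<open>inj_tuple_sum_ratio\<close>). Therefore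
  the squared residual is at most \<open>(k + 1)\<^sup>2 (t - k) \<mu> / (1 + s)\<close>.

  Since all eigenvalues are at most \<open>1\<close>, the definition of \<open>\<alpha>\<close> yields \<open>1 - \<alpha> \<le> s / k\<close>,
  and with this the constant is at most \<open>(t - k + 1) t / (1 - \<surd>\<alpha>)\<^sup>2\<close>
  (lemma \<open>selection_constant_bound\<close>). Finally, \<open>\<mu>\<close> is at most the squared spectral error of every
  approximation of rank at most \<open>k\<close>, by the Eckart--Young argument
  (lemma \<open>eigenvalue_le_low_rank_error\<close>).
\<close>

section \<open>Minors along tuples of indices\<close>

text \<open>
  The index maps are arbitrary functions, neither increasing nor injective. A tuple with a repeated
  entry has the minor zero, so sums over index sets can be taken over all tuples, and those factorise.
\<close>
definition minor :: "nat \<Rightarrow> real mat \<Rightarrow> (nat \<Rightarrow> nat) \<Rightarrow> (nat \<Rightarrow> nat) \<Rightarrow> real" where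
  "minor k A f g = det (mat k k (\<lambda>(i, j). A $$ (f i, g j)))"

abbreviation tuples :: "nat \<Rightarrow> nat \<Rightarrow> (nat \<Rightarrow> nat) set" where
  "tuples k n \<equiv> {0..<k} \<rightarrow>\<^sub>E {0..<n}"

lemma minor_expand:
  "minor k A f g = (\<Sum>p | p permutes {0..<k}. signof p * (\<Prod>i = 0..<k. A $$ (f i, g (p i))))"
proof -
  have "minor k A f g = (\<Sum>p | p permutes {0..<k}. signof p *
      (\<Prod>i = 0..<k. mat k k (\<lambda>(i, j). A $$ (f i, g j)) $$ (i, p i)))"
    unfolding minor_def by (rule det_def') simp
  also have "\<dots> = (\<Sum>p | p permutes {0..<k}. signof p * (\<Prod>i = 0..<k. A $$ (f i, g (p i))))"
    by (intro sum.cong refl arg_cong2[where f = "(*)"] prod.cong) (auto dest: permutes_in_image)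
  finally show ?thesis .
qed

lemma minor_transpose:
  assumes "A \<in> carrier_mat n d" "\<And>i. i < k \<Longrightarrow> f i < n" "\<And>i. i < k \<Longrightarrow> g i < d"
  shows "minor k A\<^sup>T g f = minor k A f g"
proof -
  have "mat k k (\<lambda>(i, j). A\<^sup>T $$ (g i, f j)) = (mat k k (\<lambda>(i, j). A $$ (f i, g j)))\<^sup>T"
    using assms by (intro eq_matI) auto
  then show ?thesis
    unfolding minor_def by (simp add: det_transpose[of _ k])
qed

lemma minor_permute_rows:
  assumes "p permutes {0..<k}"
  shows "minor k A (f \<circ> p) g = signof p * minor k A f g"
proof -
  have "mat k k (\<lambda>(i, j). A $$ ((f \<circ> p) i, g j)) =
    mat k k (\<lambda>(i, j). mat k k (\<lambda>(i, j). A $$ (f i, g j)) $$ (p i, j))"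
    using assms by (intro eq_matI) (auto dest: permutes_in_image[of _ _ "_::nat"])
  then show ?thesis
    unfolding minor_def using det_permute_rows[OF _ assms, of "mat k k (\<lambda>(i, j). A $$ (f i, g j))"]
    by simp
qed

lemma minor_permute_cols:
  assumes "p permutes {0..<k}"
  shows "minor k A f (g \<circ> p) = signof p * minor k A f g"
proof -
  have tr: "minor k A f h = det (mat k k (\<lambda>(i, j). A $$ (f j, h i)))" for h
  proof -
    have "mat k k (\<lambda>(i, j). A $$ (f j, h i)) = (mat k k (\<lambda>(i, j). A $$ (f i, h j)))\<^sup>T"
      by (intro eq_matI) auto
    then show ?thesis unfolding minor_def by (simp add: det_transpose[of _ k])
  qed
  have "mat k k (\<lambda>(i, j). A $$ (f j, (g \<circ> p) i)) =
    mat k k (\<lambda>(i, j). mat k k (\<lambda>(i, j). A $$ (f j, g i)) $$ (p i, j))"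
    using assms by (intro eq_matI) (auto dest: permutes_in_image[of _ _ "_::nat"])
  then show ?thesis
    unfolding tr using det_permute_rows[OF _ assms, of "mat k k (\<lambda>(i, j). A $$ (f j, g i))"]
    by simp
qed

lemma minor_sq_permute:
  assumes "p permutes {0..<k}" "q permutes {0..<k}"
  shows "(minor k A (f \<circ> p) (g \<circ> q))\<^sup>2 = (minor k A f g)\<^sup>2"
proof -
  have s: "(signof p * x)\<^sup>2 = (x :: real)\<^sup>2" for p :: "nat \<Rightarrow> nat" and x
    by (cases p rule: sign_cases) auto
  show ?thesis
    by (simp add: minor_permute_rows[OF assms(1)] minor_permute_cols[OF assms(2)] s)
qed

lemma inj_on_if_minor_nonzero:
  assumes "minor k A f g \<noteq> 0"
  shows "inj_on f {0..<k}" "inj_on g {0..<k}"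
proof -
  show "inj_on f {0..<k}"
  proof (rule inj_onI, rule ccontr)
    fix i j assume ij: "i \<in> {0..<k}" "j \<in> {0..<k}" "f i = f j" "i \<noteq> j"
    then have "minor k A f g = 0" unfolding minor_def
      by (intro det_identical_rows[of _ k i j] eq_vecI) auto
    then show False using assms by simp
  qed
  show "inj_on g {0..<k}"
  proof (rule inj_onI, rule ccontr)
    fix i j assume ij: "i \<in> {0..<k}" "j \<in> {0..<k}" "g i = g j" "i \<noteq> j"
    then have "minor k A f g = 0" unfolding minor_def
      by (intro det_identical_columns[of _ k i j] eq_vecI) auto
    then show False using assms by simp
  qed
qed

text \<open>
  The enumeration \<open>pick S\<close> of a set in increasing order is the one that \<open>submatrix\<close> uses, so this
  permutation leads from an arbitrary tuple to the submatrix on its range.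
\<close>
lemma sorting_permutation:
  assumes f: "inj_on f {0..<k}"
  obtains p where "p permutes {0..<k}" "\<And>i. i < k \<Longrightarrow> pick (f ` {0..<k}) i = f (p i)"
proof -
  let ?S = "f ` {0..<k}"
  have card: "card ?S = k" using card_image[OF f] by simp
  have b: "bij_betw f {0..<k} ?S" using f by (rule inj_on_imp_bij_betw)
  have inj: "inj_on (pick ?S) {0..<k}"
  proof (rule linorder_inj_onI)
    fix i j assume "i < j" "i \<in> {0..<k}" "j \<in> {0..<k}"
    then show "pick ?S i \<noteq> pick ?S j" using pick_mono_le[of j ?S i] card by auto
  qed auto
  have sub: "pick ?S ` {0..<k} \<subseteq> ?S" using pick_in_set_le[of _ ?S] card by auto
  have "pick ?S ` {0..<k} = ?S"
    using card_subset_eq[OF _ sub] card_image[OF inj] card by simp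
  then have b': "bij_betw (pick ?S) {0..<k} ?S" using inj by (simp add: bij_betw_def)
  define p where "p i = (if i < k then inv_into {0..<k} f (pick ?S i) else i)" for i
  have "bij_betw (inv_into {0..<k} f \<circ> pick ?S) {0..<k} {0..<k}"
    using b' bij_betw_inv_into[OF b] by (rule bij_betw_trans)
  then have "bij_betw p {0..<k} {0..<k}"
    by (rule bij_betw_cong[THEN iffD1, rotated]) (simp add: p_def)
  then have "p permutes {0..<k}" by (rule bij_imp_permutes) (simp add: p_def)
  moreover have "pick ?S i = f (p i)" if "i < k" for i
  proof -
    have "pick ?S i \<in> ?S" using sub that by (meson atLeastLessThan_iff image_subset_iff le0)
    from f_inv_into_f[OF this] show ?thesis using that by (simp add: p_def)
  qed
  ultimately show ?thesis by (rule that)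
qed

text \<open>
  Squared minors do not depend on the order of the indices, and a permutation of the first \<open>k\<close>
  indices also acts on the bordered minors, where it fixes the last index. Hence the minor of
  \<open>submatrix A S W\<close> and all its bordered minors have the same squares as those of the unsorted tuples.
\<close>
lemma minor_sq_pick:
  assumes A: "A \<in> carrier_mat n d" and f: "f \<in> tuples k n" and g: "g \<in> tuples k d"
    and nz: "minor k A f g \<noteq> 0"
  defines "S \<equiv> f ` {0..<k}" and "W \<equiv> g ` {0..<k}"
  shows "S \<subseteq> {0..<n}" "card S = k" "W \<subseteq> {0..<d}" "card W = k"
    and "submatrix A S W = mat k k (\<lambda>(i, j). A $$ (pick S i, pick W j))"
    and "(minor k A (pick S) (pick W))\<^sup>2 = (minor k A f g)\<^sup>2"
    and "(minor (Suc k) A ((pick S)(k := r)) ((pick W)(k := c)))\<^sup>2 = (minor (Suc k) A (f(k := r)) (g(k := c)))\<^sup>2"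
proof -
  note inj = inj_on_if_minor_nonzero[OF nz]
  show S: "S \<subseteq> {0..<n}" and W: "W \<subseteq> {0..<d}" using f g by (auto simp: S_def W_def PiE_iff)
  show cS: "card S = k" and cW: "card W = k"
    using card_image[OF inj(1)] card_image[OF inj(2)] by (simp_all add: S_def W_def)
  have "{i. i < n \<and> i \<in> S} = S" "{j. j < d \<and> j \<in> W} = W" using S W by auto
  then show "submatrix A S W = mat k k (\<lambda>(i, j). A $$ (pick S i, pick W j))"
    using A cS cW by (simp add: submatrix_def)
  obtain p where p: "p permutes {0..<k}" "\<forall>i < k. pick S i = f (p i)"
    using sorting_permutation[OF inj(1)] unfolding S_def by blast
  obtain q where q: "q permutes {0..<k}" "\<forall>i < k. pick W i = g (q i)"
    using sorting_permutation[OF inj(2)] unfolding W_def by blast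
  have "minor k A (pick S) (pick W) = minor k A (f \<circ> p) (g \<circ> q)"
    unfolding minor_def using p q by (intro arg_cong[of _ _ det] eq_matI) auto
  then show "(minor k A (pick S) (pick W))\<^sup>2 = (minor k A f g)\<^sup>2"
    using minor_sq_permute[OF p(1) q(1)] by simp
  have p': "p permutes {0..<Suc k}" "q permutes {0..<Suc k}"
    using permutes_subset[OF p(1)] permutes_subset[OF q(1)] by auto
  have ext: "(w(k := y)) i = (h(k := y) \<circ> s) i"
    if "s permutes {0..<k}" "\<forall>i < k. w i = h (s i)" "i < Suc k" for h w s i and y :: nat
  proof (cases "i = k")
    case True
    then show ?thesis using permutes_not_in[OF that(1), of k] by simp
  next
    case False
    then have "i < k" "s i < k" using that permutes_in_image[OF that(1), of i] by auto
    then show ?thesis using that(2) by simp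
  qed
  have "minor (Suc k) A ((pick S)(k := r)) ((pick W)(k := c)) =
      minor (Suc k) A (f(k := r) \<circ> p) (g(k := c) \<circ> q)"
    unfolding minor_def
    by (intro arg_cong[of _ _ det] eq_matI)
      (simp_all only: index_mat dim_row_mat dim_col_mat case_prod_conv ext[OF p] ext[OF q])
  then show "(minor (Suc k) A ((pick S)(k := r)) ((pick W)(k := c)))\<^sup>2 =
      (minor (Suc k) A (f(k := r)) (g(k := c)))\<^sup>2"
    using minor_sq_permute[OF p'] by simp
qed

lemma minor_zero_if_rank_less:
  assumes A: "A \<in> carrier_mat n d" and f: "f \<in> tuples k n" and g: "g \<in> tuples k d"
    and rank: "vec_space.rank n A < k"
  shows "minor k A f g = 0"
proof (rule ccontr)
  assume nz: "minor k A f g \<noteq> 0"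
  note pick = minor_sq_pick[OF A f g nz]
  have "{j. j < d \<and> j \<in> g ` {0..<k}} = g ` {0..<k}" using pick(3) by auto
  moreover have "det (submatrix A (f ` {0..<k}) (g ` {0..<k})) \<noteq> 0"
    using nz pick(6) unfolding pick(5) minor_def[symmetric] by (metis zero_eq_power2)
  ultimately show False
    using vec_space.rank_gt_minor[OF A] pick(4) rank by fastforce
qed

section \<open>Sums of squared minors\<close>

text \<open>
  The Cauchy--Binet formula for a Gram matrix. Expanding both factors over permutations \<open>p\<close> and
  \<open>q\<close>, the sum over the tuple \<open>f\<close> factorises into entries of \<open>A\<^sup>T A\<close>. For fixed \<open>p\<close>, the
  sum over \<open>q\<close> is the determinant of the Gram matrix with its rows permuted by \<open>p\<close>; the two
  signs of \<open>p\<close> cancel, and each of the \<open>k!\<close> permutations \<open>p\<close> contributes the same determinant.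
\<close>
lemma sum_minor_sq_rows:
  assumes A: "A \<in> carrier_mat n d" and g: "\<And>i. i < k \<Longrightarrow> g i < d"
  shows "(\<Sum>f \<in> tuples k n. (minor k A f g)\<^sup>2) = fact k * minor k (A\<^sup>T * A) g g"
proof -
  let ?P = "{p. p permutes {0..<k}}"
  let ?G = "mat k k (\<lambda>(i, j). (A\<^sup>T * A) $$ (g i, g j))"
  have G: "(A\<^sup>T * A) $$ (g i, g j) = (\<Sum>r = 0..<n. A $$ (r, g i) * A $$ (r, g j))"
    if "i < k" "j < k" for i j
    using A g[OF that(1)] g[OF that(2)] by (simp add: scalar_prod_def)
  have "(\<Sum>f \<in> tuples k n. (minor k A f g)\<^sup>2) =
    (\<Sum>f \<in> tuples k n. \<Sum>p \<in> ?P. \<Sum>q \<in> ?P. signof p * signof q *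
      (\<Prod>i = 0..<k. A $$ (f i, g (p i)) * A $$ (f i, g (q i))))"
    unfolding minor_expand power2_eq_square sum_product
    by (simp add: prod.distrib mult_ac)
  also have "\<dots> = (\<Sum>p \<in> ?P. \<Sum>q \<in> ?P. signof p * signof q *
      (\<Sum>f \<in> tuples k n. \<Prod>i = 0..<k. A $$ (f i, g (p i)) * A $$ (f i, g (q i))))"
    unfolding sum_distrib_left
    by (subst sum.swap, rule sum.cong[OF refl], subst sum.swap, rule refl)
  also have "\<dots> = (\<Sum>p \<in> ?P. \<Sum>q \<in> ?P. signof p * signof q *
      (\<Prod>i = 0..<k. \<Sum>r = 0..<n. A $$ (r, g (p i)) * A $$ (r, g (q i))))"
    by (subst prod_sum_PiE) auto
  also have "\<dots> = (\<Sum>p \<in> ?P. det ?G)"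
  proof (rule sum.cong[OF refl])
    fix p assume "p \<in> ?P"
    then have p: "p permutes {0..<k}" by simp
    have pk: "p i < k" if "i < k" for i using permutes_in_image[OF p, of i] that by simp
    have qk: "q i < k" if "q permutes {0..<k}" "i < k" for i q
      using permutes_in_image[OF that(1), of i] that by simp
    have "(\<Sum>q \<in> ?P. signof p * signof q *
        (\<Prod>i = 0..<k. \<Sum>r = 0..<n. A $$ (r, g (p i)) * A $$ (r, g (q i)))) =
      signof p * (\<Sum>q \<in> ?P. signof q * (\<Prod>i = 0..<k. mat k k (\<lambda>(i, j). ?G $$ (p i, j)) $$ (i, q i)))"
      unfolding sum_distrib_left mult.assoc
      by (intro sum.cong refl arg_cong2[where f = "(*)"] prod.cong) (auto simp: pk qk G[symmetric])
    also have "\<dots> = signof p * det (mat k k (\<lambda>(i, j). ?G $$ (p i, j)))"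
      by (subst det_def'[of _ k]) auto
    also have "\<dots> = signof p * (signof p * det ?G)"
      by (subst det_permute_rows[OF _ p]) auto
    also have "\<dots> = det ?G" by (cases p rule: sign_cases) auto
    finally show "(\<Sum>q \<in> ?P. signof p * signof q *
        (\<Prod>i = 0..<k. \<Sum>r = 0..<n. A $$ (r, g (p i)) * A $$ (r, g (q i)))) = det ?G" .
  qed
  also have "\<dots> = fact k * minor k (A\<^sup>T * A) g g"
    by (simp add: minor_def card_permutations[of _ k])
  finally show ?thesis .
qed

lemma sum_minor_sq_cols:
  assumes A: "A \<in> carrier_mat n d" and f: "\<And>i. i < k \<Longrightarrow> f i < n"
  shows "(\<Sum>g \<in> tuples k d. (minor k A f g)\<^sup>2) = fact k * minor k (A * A\<^sup>T) f f"
proof -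
  have "(\<Sum>g \<in> tuples k d. (minor k A f g)\<^sup>2) = (\<Sum>g \<in> tuples k d. (minor k A\<^sup>T g f)\<^sup>2)"
    using f by (intro sum.cong refl) (subst minor_transpose[OF A], auto simp: PiE_iff)
  also have "\<dots> = fact k * minor k (A\<^sup>T\<^sup>T * A\<^sup>T) f f"
    using A f by (intro sum_minor_sq_rows) auto
  finally show ?thesis by simp
qed

definition minors_sq_sum :: "nat \<Rightarrow> real mat \<Rightarrow> real" where
  "minors_sq_sum k A =
     (\<Sum>f \<in> tuples k (dim_row A). \<Sum>g \<in> tuples k (dim_col A). (minor k A f g)\<^sup>2)"

text \<open>
  For fixed rows, the sum over the columns is a principal minor of \<open>A A\<^sup>T = (A U) (A U)\<^sup>T\<close>.
\<close>
lemma minors_sq_sum_orthogonal: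
  assumes A: "A \<in> carrier_mat n d" and U: "U \<in> carrier_mat d d" and UU: "U * U\<^sup>T = 1\<^sub>m d"
  shows "minors_sq_sum k (A * U) = minors_sq_sum k A"
proof -
  have AU: "A * U \<in> carrier_mat n d" using A U by simp
  have "(A * U) * (A * U)\<^sup>T = A * U * (U\<^sup>T * A\<^sup>T)"
    using A U by (simp add: transpose_mult)
  also have "\<dots> = A * (U * (U\<^sup>T * A\<^sup>T))"
    using A U by (intro assoc_mult_mat[where ?n\<^sub>3.0 = d]) auto
  also have "U * (U\<^sup>T * A\<^sup>T) = U * U\<^sup>T * A\<^sup>T"
    using A U by (intro assoc_mult_mat[symmetric]) auto
  also have "\<dots> = A\<^sup>T" using A by (simp add: UU)
  finally have eq: "(A * U) * (A * U)\<^sup>T = A * A\<^sup>T" .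
  have "(\<Sum>f \<in> tuples k n. \<Sum>g \<in> tuples k d. (minor k (A * U) f g)\<^sup>2) =
      (\<Sum>f \<in> tuples k n. \<Sum>g \<in> tuples k d. (minor k A f g)\<^sup>2)"
  proof (rule sum.cong[OF refl])
    fix f assume "f \<in> tuples k n"
    then have f: "\<And>i. i < k \<Longrightarrow> f i < n" by (auto simp: PiE_iff)
    show "(\<Sum>g \<in> tuples k d. (minor k (A * U) f g)\<^sup>2) = (\<Sum>g \<in> tuples k d. (minor k A f g)\<^sup>2)"
      using sum_minor_sq_cols[OF A f] sum_minor_sq_cols[OF AU f] eq by simp
  qed
  then show ?thesis
    unfolding minors_sq_sum_def using A U by simp
qed

lemma minor_diagonal:
  "minor k (mat d d (\<lambda>(a, b). if a = b then l a else 0)) h h =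
     (if inj_on h {0..<k} then \<Prod>i = 0..<k. l (h i) else 0)"
  if h: "\<And>i. i < k \<Longrightarrow> h i < d" for l :: "nat \<Rightarrow> real"
proof -
  let ?D = "mat k k (\<lambda>(i, j). mat d d (\<lambda>(a, b). if a = b then l a else 0) $$ (h i, h j))"
  have D: "?D $$ (i, j) = (if h i = h j then l (h i) else 0)" if "i < k" "j < k" for i j
    using that h by simp
  show ?thesis
  proof (cases "inj_on h {0..<k}")
    case True
    have "det ?D = prod_list (diag_mat ?D)"
    proof (rule det_upper_triangular[of _ k])
      show "upper_triangular ?D"
        using True by (fastforce simp: upper_triangular_def D inj_on_def simp del: index_mat(1))
    qed simp
    also have "\<dots> = (\<Prod>i = 0..<k. ?D $$ (i, i))"
      by (simp add: prod_list_diag_prod)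
    also have "\<dots> = (\<Prod>i = 0..<k. l (h i))"
      by (intro prod.cong) (auto simp: h)
    finally show ?thesis using True by (simp add: minor_def)
  next
    case False
    then obtain i j where ij: "i < k" "j < k" "i \<noteq> j" "h i = h j"
      by (auto simp: inj_on_def)
    have "det ?D = 0"
    proof (rule det_identical_columns[of _ k i j])
      show "col ?D i = col ?D j" using ij by (intro eq_vecI) auto
    qed (use ij in auto)
    then show ?thesis using False by (simp add: minor_def)
  qed
qed

abbreviation inj_tuples :: "nat \<Rightarrow> nat set \<Rightarrow> (nat \<Rightarrow> nat) set" where
  "inj_tuples k I \<equiv> {h \<in> {0..<k} \<rightarrow>\<^sub>E I. inj_on h {0..<k}}"

text \<open>
  This is \<open>k!\<close> times the elementary symmetric polynomial of degree \<open>k\<close> in the values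
  \<open>l i\<close>, \<open>i \<in> I\<close>. Tuples instead of subsets avoid counting the orderings of a set.
\<close>
definition inj_tuple_sum :: "nat \<Rightarrow> nat set \<Rightarrow> (nat \<Rightarrow> real) \<Rightarrow> real" where
  "inj_tuple_sum k I l = (\<Sum>h \<in> inj_tuples k I. \<Prod>i = 0..<k. l (h i))"

lemma minors_sq_sum_diagonal_gram:
  assumes B: "B \<in> carrier_mat n d" 
    and D: "B\<^sup>T * B = mat d d (\<lambda>(a, b). if a = b then l a else 0)"
  shows "minors_sq_sum k B = fact k * inj_tuple_sum k {0..<d} l"
proof -
  have "minors_sq_sum k B = (\<Sum>g \<in> tuples k d. \<Sum>f \<in> tuples k n. (minor k B f g)\<^sup>2)"
    unfolding minors_sq_sum_def using B by (subst sum.swap) auto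
  also have "\<dots> = (\<Sum>g \<in> tuples k d. fact k * (if inj_on g {0..<k} then \<Prod>i = 0..<k. l (g i) else 0))"
  proof (rule sum.cong[OF refl])
    fix g assume "g \<in> tuples k d"
    then have g: "\<And>i. i < k \<Longrightarrow> g i < d" by (auto simp: PiE_iff)
    show "(\<Sum>f \<in> tuples k n. (minor k B f g)\<^sup>2) =
        fact k * (if inj_on g {0..<k} then \<Prod>i = 0..<k. l (g i) else 0)"
      using sum_minor_sq_rows[OF B g] minor_diagonal[OF g, where l = l] by (simp add: D)
  qed
  also have "\<dots> = fact k * inj_tuple_sum k {0..<d} l"
    unfolding inj_tuple_sum_def sum_distrib_left
    by (intro sum.mono_neutral_cong_right) (auto intro: finite_PiE)
  finally show ?thesis .
qed

section \<open>Elementary symmetric sums over injective tuples\<close>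

lemma sum_tuples_Suc:
  fixes F :: "(nat \<Rightarrow> nat) \<Rightarrow> real"
  assumes "finite I"
  shows "(\<Sum>h \<in> {0..<Suc k} \<rightarrow>\<^sub>E I. F h) = (\<Sum>f \<in> {0..<k} \<rightarrow>\<^sub>E I. \<Sum>r \<in> I. F (f(k := r)))"
proof -
  have "(\<Sum>h \<in> {0..<Suc k} \<rightarrow>\<^sub>E I. F h) = (\<Sum>(f, r) \<in> ({0..<k} \<rightarrow>\<^sub>E I) \<times> I. F (f(k := r)))"
    by (rule sum.reindex_bij_witness[of _ "\<lambda>(f, r). f(k := r)" "\<lambda>h. (h(k := undefined), h k)"])
      (auto simp: PiE_def extensional_def less_Suc_eq)
  then show ?thesis
    by (simp add: sum.cartesian_product)
qed

lemma sum_inj_tuples_Suc: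
  fixes F :: "(nat \<Rightarrow> nat) \<Rightarrow> real"
  assumes "finite I"
  shows "(\<Sum>h \<in> inj_tuples (Suc k) I. F h) =
    (\<Sum>f \<in> inj_tuples k I. \<Sum>r \<in> I - f ` {0..<k}. F (f(k := r)))"
proof -
  have fin: "finite ({0..<j} \<rightarrow>\<^sub>E I)" for j :: nat using assms by (intro finite_PiE) auto
  have inj: "inj_on (f(k := r)) {0..<Suc k} \<longleftrightarrow> inj_on f {0..<k} \<and> r \<notin> f ` {0..<k}" for f r
  proof -
    have "inj_on (f(k := r)) {0..<Suc k} \<longleftrightarrow> inj_on (f(k := r)) (insert k {0..<k})"
      by (simp add: atLeast0_lessThan_Suc)
    also have "\<dots> \<longleftrightarrow> inj_on (f(k := r)) {0..<k} \<and> r \<notin> (f(k := r)) ` {0..<k}"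
      by (subst inj_on_insert) auto
    also have "(f(k := r)) ` {0..<k} = f ` {0..<k}" by auto
    also have "inj_on (f(k := r)) {0..<k} \<longleftrightarrow> inj_on f {0..<k}"
      by (rule inj_on_cong) auto
    finally show ?thesis .
  qed
  have "(\<Sum>h \<in> inj_tuples (Suc k) I. F h) =
      (\<Sum>h \<in> {0..<Suc k} \<rightarrow>\<^sub>E I. if inj_on h {0..<Suc k} then F h else 0)"
    using fin by (intro sum.mono_neutral_cong_left) auto
  also have "\<dots> = (\<Sum>f \<in> {0..<k} \<rightarrow>\<^sub>E I. \<Sum>r \<in> I.
      if inj_on f {0..<k} \<and> r \<notin> f ` {0..<k} then F (f(k := r)) else 0)"
    by (subst sum_tuples_Suc[OF assms], unfold inj) simp
  also have "\<dots> = (\<Sum>f \<in> {0..<k} \<rightarrow>\<^sub>E I.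
      if inj_on f {0..<k} then \<Sum>r \<in> I - f ` {0..<k}. F (f(k := r)) else 0)"
    using assms by (intro sum.cong refl) (auto intro!: sum.mono_neutral_cong_right)
  also have "\<dots> = (\<Sum>f \<in> inj_tuples k I. \<Sum>r \<in> I - f ` {0..<k}. F (f(k := r)))"
    using fin by (intro sum.mono_neutral_cong_right) auto
  finally show ?thesis .
qed

text \<open>
  By symmetry, the omitted position may be taken to be the last one. Its entry is then free, and
  there are \<open>card I - k\<close> choices that keep the tuple injective. If \<open>card I < k\<close>, both sides vanish.
\<close>
lemma inj_tuple_sum_omit:
  assumes "finite I" "m \<le> k"
  shows "(\<Sum>h \<in> inj_tuples (Suc k) I. \<Prod>i \<in> {0..<Suc k} - {m}. l (h i)) =
    (real (card I) - real k) * inj_tuple_sum k I l"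
proof -
  let ?H = "\<lambda>j. inj_tuples j I"
  let ?t = "Transposition.transpose m k"
  have t: "?t permutes {0..<Suc k}"
    using assms by (intro permutes_swap_id) auto
  have bt: "bij_betw ?t {0..<Suc k} {0..<Suc k}" using t by (rule permutes_imp_bij)
  have comp: "h \<circ> ?t \<in> ?H (Suc k)" if "h \<in> ?H (Suc k)" for h
    using that bt permutes_not_in[OF t] permutes_in_image[OF t]
    by (auto simp: PiE_iff extensional_def bij_betw_def intro!: comp_inj_on)
  have "(\<Sum>h \<in> ?H (Suc k). \<Prod>i \<in> {0..<Suc k} - {m}. l (h i)) =
      (\<Sum>h \<in> ?H (Suc k). \<Prod>i = 0..<k. l (h i))"
  proof (rule sum.reindex_bij_witness[of _ "\<lambda>h. h \<circ> ?t" "\<lambda>h. h \<circ> ?t"])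
    fix h
    have "(\<Prod>i = 0..<k. l ((h \<circ> ?t) i)) = (\<Prod>i \<in> {0..<Suc k} - {m}. l (h i))"
      using assms(2)
      by (intro prod.reindex_bij_witness[of _ ?t ?t]) (auto simp: transpose_def)
    then show "(\<Prod>i = 0..<k. l ((h \<circ> ?t) i)) = (\<Prod>i \<in> {0..<Suc k} - {m}. l (h i))" .
  qed (use comp in \<open>auto simp: o_assoc[symmetric] comp_assoc\<close>)
  also have "\<dots> = (\<Sum>f \<in> ?H k. \<Sum>r \<in> I - f ` {0..<k}. \<Prod>i = 0..<k. l ((f(k := r)) i))"
    using assms(1) by (rule sum_inj_tuples_Suc)
  also have "\<dots> = (\<Sum>f \<in> ?H k. (real (card I) - real k) * (\<Prod>i = 0..<k. l (f i)))"
  proof (rule sum.cong[OF refl])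
    fix f assume "f \<in> ?H k"
    then have f: "f ` {0..<k} \<subseteq> I" "inj_on f {0..<k}" by auto
    have "card (f ` {0..<k}) = k" using card_image[OF f(2)] by simp
    moreover have "card (f ` {0..<k}) \<le> card I" using f(1) assms(1) by (rule card_mono[rotated])
    ultimately have "real (card (I - f ` {0..<k})) = real (card I) - real k"
      using f(1) by (subst card_Diff_subset) (auto simp: of_nat_diff)
    moreover have "(\<Prod>i = 0..<k. l ((f(k := r)) i)) = (\<Prod>i = 0..<k. l (f i))" for r
      by (intro prod.cong) auto
    ultimately show "(\<Sum>r \<in> I - f ` {0..<k}. \<Prod>i = 0..<k. l ((f(k := r)) i)) =
        (real (card I) - real k) * (\<Prod>i = 0..<k. l (f i))"
      by simp
  qed
  also have "\<dots> = (real (card I) - real k) * inj_tuple_sum k I l"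
    by (simp add: inj_tuple_sum_def sum_distrib_left)
  finally show ?thesis .
qed

text \<open>
  Outside of \<open>T \<inter> K\<close>, the set \<open>T\<close> has one element more than \<open>K\<close>, and its elements there weigh
  at least \<open>1\<close>, whereas those of \<open>K\<close> weigh at most \<open>1\<close>.
\<close>
lemma top_sum_le_sum:
  fixes x :: "nat \<Rightarrow> real"
  assumes "finite T" "card T = Suc (card K)" "finite K"
    and "\<And>i. i \<in> K \<Longrightarrow> x i \<le> 1" "\<And>i. i \<in> T - K \<Longrightarrow> 1 \<le> x i"
  shows "1 + (\<Sum>i \<in> K. x i) \<le> (\<Sum>i \<in> T. x i)"
proof -
  have T: "(\<Sum>i \<in> T. x i) = (\<Sum>i \<in> T \<inter> K. x i) + (\<Sum>i \<in> T - K. x i)"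
    using assms(1) by (metis sum.Int_Diff)
  have K: "(\<Sum>i \<in> K. x i) = (\<Sum>i \<in> T \<inter> K. x i) + (\<Sum>i \<in> K - T. x i)"
    using assms(3) by (metis Int_commute sum.Int_Diff)
  have c: "card T = card (T \<inter> K) + card (T - K)" "card K = card (T \<inter> K) + card (K - T)"
    using assms(1,3) by (metis card_Int_Diff, metis card_Int_Diff Int_commute)
  have "1 + (\<Sum>i \<in> K - T. x i) \<le> 1 + real (card (K - T))"
    using sum_bounded_above[of "K - T" x 1] assms(4) by simp
  also have "\<dots> = real (card (T - K))" using c assms(2) by simp
  also have "\<dots> \<le> (\<Sum>i \<in> T - K. x i)"
    using sum_bounded_below[of "T - K" 1 x] assms(5) by simp
  finally show ?thesis unfolding T K by simp
qed

text \<open>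
  The inequality \<open>(1 + s) e\<^sub>k\<^sub>+\<^sub>1 \<le> (card I - k) \<mu> e\<^sub>k\<close>, stated for tuples. It holds for each injective
  tuple \<open>h\<close> separately: \<open>top_sum_le_sum\<close> with \<open>x\<^sub>i = \<mu> / l i\<close> on the range of \<open>h\<close>, multiplied
  by the product of the \<open>l (h i)\<close>, bounds the left side by \<open>\<mu>\<close> times the products that omit one position.
  It is sharp when the values \<open>l i\<close> all agree.
\<close>
lemma inj_tuple_sum_ratio:
  assumes I: "finite I" and K: "K \<subseteq> I" "card K = k" and mu: "0 < \<mu>"
    and top: "\<And>i. i \<in> K \<Longrightarrow> \<mu> \<le> l i"
    and bot: "\<And>i. i \<in> I - K \<Longrightarrow> 0 < l i \<and> l i \<le> \<mu>"
  shows "(1 + (\<Sum>i \<in> K. \<mu> / l i)) * inj_tuple_sum (Suc k) I l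
    \<le> real (Suc k) * (real (card I) - real k) * \<mu> * inj_tuple_sum k I l"
proof -
  let ?H = "inj_tuples (Suc k) I"
  have pos: "0 < l i" if "i \<in> I" for i using that mu top[of i] bot[of i] by (cases "i \<in> K") auto
  have finK: "finite K" using I K finite_subset by blast
  have "(1 + (\<Sum>i \<in> K. \<mu> / l i)) * inj_tuple_sum (Suc k) I l =
      (\<Sum>h \<in> ?H. (1 + (\<Sum>i \<in> K. \<mu> / l i)) * (\<Prod>i = 0..<Suc k. l (h i)))"
    unfolding inj_tuple_sum_def by (rule sum_distrib_left)
  also have "\<dots> \<le> (\<Sum>h \<in> ?H. \<mu> * (\<Sum>m = 0..<Suc k. \<Prod>i \<in> {0..<Suc k} - {m}. l (h i)))"
  proof (rule sum_mono)
    fix h assume h: "h \<in> ?H"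
    let ?T = "h ` {0..<Suc k}"
    have inj: "inj_on h {0..<Suc k}" and T: "?T \<subseteq> I" using h by auto
    have hI: "h i \<in> I" if "i < Suc k" for i using T that by auto
    have "1 + (\<Sum>i \<in> K. \<mu> / l i) \<le> (\<Sum>i \<in> ?T. \<mu> / l i)"
    proof (rule top_sum_le_sum)
      show "card ?T = Suc (card K)" using card_image[OF inj] K by simp
      show "\<mu> / l i \<le> 1" if "i \<in> K" for i using top[OF that] pos[of i] that K by auto
      show "1 \<le> \<mu> / l i" if "i \<in> ?T - K" for i using bot[of i] T that by auto
    qed (use finK in auto)
    also have "\<dots> = (\<Sum>m = 0..<Suc k. \<mu> / l (h m))"
      using sum.reindex[OF inj] by simp
    finally have "(1 + (\<Sum>i \<in> K. \<mu> / l i)) * (\<Prod>i = 0..<Suc k. l (h i)) \<le>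
        (\<Sum>m = 0..<Suc k. \<mu> / l (h m)) * (\<Prod>i = 0..<Suc k. l (h i))"
      using hI pos by (intro mult_right_mono prod_nonneg) (auto intro: less_imp_le)
    also have "\<dots> = (\<Sum>m = 0..<Suc k. \<mu> * (\<Prod>i \<in> {0..<Suc k} - {m}. l (h i)))"
      unfolding sum_distrib_right
    proof (rule sum.cong[OF refl])
      fix m assume m: "m \<in> {0..<Suc k}"
      have "(\<Prod>i = 0..<Suc k. l (h i)) = l (h m) * (\<Prod>i \<in> {0..<Suc k} - {m}. l (h i))"
        using m by (intro prod.remove) auto
      then show "\<mu> / l (h m) * (\<Prod>i = 0..<Suc k. l (h i)) = \<mu> * (\<Prod>i \<in> {0..<Suc k} - {m}. l (h i))"
        using pos[OF hI, of m] m by simp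
    qed
    finally show "(1 + (\<Sum>i \<in> K. \<mu> / l i)) * (\<Prod>i = 0..<Suc k. l (h i))
        \<le> \<mu> * (\<Sum>m = 0..<Suc k. \<Prod>i \<in> {0..<Suc k} - {m}. l (h i))"
      unfolding sum_distrib_left .
  qed
  also have "\<dots> = \<mu> * (\<Sum>m = 0..<Suc k. \<Sum>h \<in> ?H. \<Prod>i \<in> {0..<Suc k} - {m}. l (h i))"
    unfolding sum_distrib_left[symmetric] by (subst sum.swap) simp
  also have "\<dots> = \<mu> * (\<Sum>m = 0..<Suc k. (real (card I) - real k) * inj_tuple_sum k I l)"
    by (intro arg_cong2[where f = "(*)"] refl sum.cong inj_tuple_sum_omit[OF I]) auto
  finally show ?thesis by (simp add: mult_ac)
qed

lemma inj_tuple_sum_support: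
  assumes "finite I" "J \<subseteq> I" "\<And>i. i \<in> I - J \<Longrightarrow> l i = 0"
  shows "inj_tuple_sum k I l = inj_tuple_sum k J l"
  unfolding inj_tuple_sum_def
proof (rule sum.mono_neutral_right)
  show "finite (inj_tuples k I)"
    using finite_PiE[of "{0..<k}" "\<lambda>_. I"] assms(1) by simp
  show "inj_tuples k J \<subseteq> inj_tuples k I"
    using assms(2) by (auto simp: PiE_iff)
  show "\<forall>h \<in> inj_tuples k I - inj_tuples k J.
      (\<Prod>i = 0..<k. l (h i)) = 0"
  proof
    fix h assume "h \<in> inj_tuples k I - inj_tuples k J"
    then obtain i where "i < k" "h i \<in> I - J" by (auto simp: PiE_iff)
    then show "(\<Prod>i = 0..<k. l (h i)) = 0" using assms(3)[of "h i"] by (intro prod_zero) auto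
  qed
qed

lemma inj_tuple_sum_pos:
  assumes "k \<le> t" "\<And>i. i < t \<Longrightarrow> 0 < l i"
  shows "0 < inj_tuple_sum k {0..<t} l"
  unfolding inj_tuple_sum_def
proof (rule sum_pos2)
  show "finite (inj_tuples k {0..<t})" using finite_PiE[of "{0..<k}" "\<lambda>_. {0..<t}"] by simp
  show "restrict (\<lambda>i. i) {0..<k} \<in> inj_tuples k {0..<t}"
    using assms(1) by (auto simp: inj_on_def)
  show "0 < (\<Prod>i = 0..<k. l (restrict (\<lambda>i. i) {0..<k} i))"
    using assms by (intro prod_pos) auto
  show "0 \<le> (\<Prod>i = 0..<k. l (h i))" if "h \<in> inj_tuples k {0..<t}" for h
    using that assms(2) by (intro prod_nonneg) (auto simp: PiE_iff intro: less_imp_le)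
qed

section \<open>Averaging over cross approximations\<close>

text \<open>
  The Schur complement formula. Column operations with \<open>Y = X\<inverse>\<close> clear the new column above the
  corner and leave the residual of the cross approximation in the corner.
\<close>
lemma minor_bordered:
  fixes A :: "real mat"
  defines "X \<equiv> \<lambda>f g k. mat k k (\<lambda>(i, j). A $$ (f i, g j))"
  assumes Y: "Y \<in> carrier_mat k k" and XY: "X f g k * Y = 1\<^sub>m k"
  shows "minor (Suc k) A (f(k := r)) (g(k := c)) =
    minor k A f g * (A $$ (r, c) - (\<Sum>p = 0..<k. \<Sum>q = 0..<k. A $$ (r, g p) * Y $$ (p, q) * A $$ (f q, c)))"
proof -
  let ?X = "X f g k"
  define b where "b = mat k 1 (\<lambda>(i, _). A $$ (f i, c))"
  define u where "u = mat 1 k (\<lambda>(_, j). A $$ (r, g j))"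
  define a where "a = mat 1 1 (\<lambda>_. A $$ (r, c))"
  note defs = b_def u_def a_def
  have X: "?X \<in> carrier_mat k k" unfolding X_def by simp
  have cs: "b \<in> carrier_mat k 1" "u \<in> carrier_mat 1 k" "a \<in> carrier_mat 1 1" unfolding defs by auto
  let ?M = "four_block_mat ?X b u a"
  let ?N = "four_block_mat (1\<^sub>m k) (- (Y * b)) (0\<^sub>m 1 k) (1\<^sub>m 1)"
  have M: "mat (Suc k) (Suc k) (\<lambda>(i, j). A $$ ((f(k := r)) i, (g(k := c)) j)) = ?M"
    by (rule eq_matI) (auto simp: X_def defs less_Suc_eq)
  have Mc: "?M \<in> carrier_mat (k + 1) (k + 1)" using X cs by auto
  have Nc: "?N \<in> carrier_mat (k + 1) (k + 1)" using Y cs by auto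
  have XYb: "?X * (Y * b) = b"
    using XY X Y cs by (metis assoc_mult_mat left_mult_one_mat)
  have "?M * ?N = four_block_mat ?X (0\<^sub>m k 1) u (a - u * (Y * b))"
    using X Y cs
    by (subst mult_four_block_mat[of _ k k _ 1 _ 1 _ _ k _ 1])
      (auto simp: XYb intro!: cong_four_block_mat eq_matI)
  moreover have "det \<dots> = det ?X * det (a - u * (Y * b))"
    using X Y cs by (intro det_four_block_mat_upper_right_zero) auto
  moreover have "det ?N = 1"
    using Y cs by (subst det_four_block_mat_lower_left_zero[of _ k _ 1]) auto
  moreover have "det (?M * ?N) = det ?M * det ?N"
    using Mc Nc by (rule det_mult)
  ultimately have "det ?M = det ?X * det (a - u * (Y * b))" by simp
  also have "det (a - u * (Y * b)) = (a - u * (Y * b)) $$ (0, 0)"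
    using cs by (intro det_single) auto
  also have "\<dots> = A $$ (r, c) - (\<Sum>p = 0..<k. \<Sum>q = 0..<k. A $$ (r, g p) * Y $$ (p, q) * A $$ (f q, c))"
    using Y by (simp add: defs scalar_prod_def sum_distrib_left mult.assoc)
  finally show ?thesis unfolding minor_def M X_def .
qed

lemma minors_sq_sum_Suc:
  "minors_sq_sum (Suc k) A =
    (\<Sum>f \<in> tuples k (dim_row A). \<Sum>g \<in> tuples k (dim_col A).
      \<Sum>r = 0..<dim_row A. \<Sum>c = 0..<dim_col A. (minor (Suc k) A (f(k := r)) (g(k := c)))\<^sup>2)"
  unfolding minors_sq_sum_def sum_tuples_Suc[OF finite_atLeastLessThan]
  by (intro sum.cong refl) (rule sum.swap)

text \<open>
  By \<open>minors_sq_sum_Suc\<close>, the sums of the squared bordered minors add up to \<open>P\<^sub>k\<^sub>+\<^sub>1\<close> over all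
  pairs \<open>(f, g)\<close>, and the squared minors add up to \<open>P\<^sub>k\<close>. If the ratio exceeded
  \<open>P\<^sub>k\<^sub>+\<^sub>1 / P\<^sub>k\<close> at each pair with a nonzero minor, summation would give a contradiction.
\<close>
lemma exists_minor_below_average:
  assumes "0 < minors_sq_sum k A"
  shows "\<exists>f \<in> tuples k (dim_row A). \<exists>g \<in> tuples k (dim_col A). minor k A f g \<noteq> 0 \<and>
    (\<Sum>r = 0..<dim_row A. \<Sum>c = 0..<dim_col A. (minor (Suc k) A (f(k := r)) (g(k := c)))\<^sup>2)
      \<le> minors_sq_sum (Suc k) A / minors_sq_sum k A * (minor k A f g)\<^sup>2"
proof (rule ccontr)
  let ?P = "tuples k (dim_row A) \<times> tuples k (dim_col A)"
  let ?Q = "\<lambda>(f, g). \<Sum>r = 0..<dim_row A. \<Sum>c = 0..<dim_col A. (minor (Suc k) A (f(k := r)) (g(k := c)))\<^sup>2"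
  let ?c = "minors_sq_sum (Suc k) A / minors_sq_sum k A"
  let ?m = "\<lambda>(f, g). (minor k A f g)\<^sup>2"
  assume "\<not> ?thesis"
  then have gt: "?c * ?m x < ?Q x" if "x \<in> ?P" "?m x \<noteq> 0" for x
    using that by (cases x) (auto simp: not_le)
  have fin: "finite ?P" by (intro finite_cartesian_product finite_PiE) auto
  have S: "minors_sq_sum k A = (\<Sum>x \<in> ?P. ?m x)"
    unfolding minors_sq_sum_def by (subst sum.cartesian_product) auto
  have S': "minors_sq_sum (Suc k) A = (\<Sum>x \<in> ?P. ?Q x)"
    unfolding minors_sq_sum_Suc by (subst sum.cartesian_product) auto
  have "(\<Sum>x \<in> ?P. ?c * ?m x) < (\<Sum>x \<in> ?P. ?Q x)"
  proof (rule sum_strict_mono_ex1[OF fin])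
    \<comment> \<open>This covers the pairs with a vanishing minor, where the left side is zero.\<close>
    have nonneg: "0 \<le> ?Q x" for x by (auto split: prod.split intro!: sum_nonneg)
    show "\<forall>x \<in> ?P. ?c * ?m x \<le> ?Q x"
      using gt nonneg by (metis less_imp_le mult_zero_right)
    have "\<exists>x \<in> ?P. ?m x \<noteq> 0"
    proof (rule ccontr)
      assume "\<not> (\<exists>x \<in> ?P. ?m x \<noteq> 0)"
      then have "(\<Sum>x \<in> ?P. ?m x) = 0" by (intro sum.neutral) blast
      then show False using assms S by simp
    qed
    then show "\<exists>x \<in> ?P. ?c * ?m x < ?Q x" using gt by blast
  qed
  also have "\<dots> = ?c * (\<Sum>x \<in> ?P. ?m x)"
    using assms unfolding S'[symmetric] S[symmetric] by simp
  finally show False by (simp add: sum_distrib_left)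
qed

lemma exists_cross_approximation:
  assumes A: "A \<in> carrier_mat n d" and pos: "0 < minors_sq_sum k A"
  shows "\<exists>S W. S \<subseteq> {0..<n} \<and> card S = k \<and> W \<subseteq> {0..<d} \<and> card W = k \<and>
    invertible_mat (submatrix A S W) \<and>
    (\<Sum>r = 0..<n. \<Sum>c = 0..<d. ((A - submatrix A UNIV W * the (mat_inverse (submatrix A S W)) *
        submatrix A S UNIV) $$ (r, c))\<^sup>2) \<le> minors_sq_sum (Suc k) A / minors_sq_sum k A"
proof -
  obtain f g where f: "f \<in> tuples k n" and g: "g \<in> tuples k d" and nz: "minor k A f g \<noteq> 0"
    and le: "(\<Sum>r = 0..<n. \<Sum>c = 0..<d. (minor (Suc k) A (f(k := r)) (g(k := c)))\<^sup>2)
      \<le> minors_sq_sum (Suc k) A / minors_sq_sum k A * (minor k A f g)\<^sup>2"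
    using exists_minor_below_average[OF pos] A by auto
  define S W where "S = f ` {0..<k}" and "W = g ` {0..<k}"
  note pick = minor_sq_pick[OF A f g nz, folded S_def W_def]
  let ?X = "submatrix A S W"
  have X: "?X \<in> carrier_mat k k" unfolding pick(5) by simp
  have detX: "det ?X = minor k A (pick S) (pick W)" unfolding pick(5) minor_def ..
  then have "det ?X \<noteq> 0" using nz pick(6) by auto
  then have "?X \<in> Units (ring_mat TYPE(real) k ())"
    by (rule det_non_zero_imp_unit[OF X])
  then obtain Y where Y: "mat_inverse ?X = Some Y"
    using mat_inverse(1)[OF X, of "()"] by (cases "mat_inverse ?X") auto
  note YX = mat_inverse(2)[OF X Y]
  then have Yc: "Y \<in> carrier_mat k k" by simp
  from YX have inv: "invertible_mat ?X"
    using X by (auto simp: invertible_mat_def inverts_mat_def)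
  let ?E = "A - submatrix A UNIV W * Y * submatrix A S UNIV"
  have setS: "{i. i < n \<and> i \<in> S} = S" and setW: "{j. j < d \<and> j \<in> W} = W" using pick by auto
  have CW: "submatrix A UNIV W = mat n k (\<lambda>(i, j). A $$ (i, pick W j))"
    and RS: "submatrix A S UNIV = mat k d (\<lambda>(i, j). A $$ (pick S i, j))"
    using A pick(2,4) setS setW by (auto simp: submatrix_def pick_UNIV)
  have E: "?E $$ (r, c) = A $$ (r, c) -
      (\<Sum>p = 0..<k. \<Sum>q = 0..<k. A $$ (r, pick W p) * Y $$ (p, q) * A $$ (pick S q, c))"
    if "r < n" "c < d" for r c
  proof -
    have "(submatrix A UNIV W * Y * submatrix A S UNIV) $$ (r, c) =
        (\<Sum>q = 0..<k. (\<Sum>p = 0..<k. A $$ (r, pick W p) * Y $$ (p, q)) * A $$ (pick S q, c))"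
      using that Yc by (simp add: CW RS scalar_prod_def)
    also have "\<dots> = (\<Sum>p = 0..<k. \<Sum>q = 0..<k. A $$ (r, pick W p) * Y $$ (p, q) * A $$ (pick S q, c))"
      unfolding sum_distrib_right by (rule sum.swap)
    finally show ?thesis using that A by (simp add: CW RS)
  qed
  have eq: "(minor k A f g)\<^sup>2 * (\<Sum>r = 0..<n. \<Sum>c = 0..<d. (?E $$ (r, c))\<^sup>2) =
      (\<Sum>r = 0..<n. \<Sum>c = 0..<d. (minor (Suc k) A (f(k := r)) (g(k := c)))\<^sup>2)"
    unfolding sum_distrib_left
  proof (intro sum.cong refl)
    fix r c assume "r \<in> {0..<n}" "c \<in> {0..<d}"
    then have "minor k A (pick S) (pick W) * ?E $$ (r, c) =
        minor (Suc k) A ((pick S)(k := r)) ((pick W)(k := c))"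
      using YX E[of r c] by (subst minor_bordered[of Y]) (auto simp: pick(5))
    then show "(minor k A f g)\<^sup>2 * (?E $$ (r, c))\<^sup>2 = (minor (Suc k) A (f(k := r)) (g(k := c)))\<^sup>2"
      by (metis pick(6,7) power_mult_distrib)
  qed
  have "(\<Sum>r = 0..<n. \<Sum>c = 0..<d. (?E $$ (r, c))\<^sup>2) \<le> minors_sq_sum (Suc k) A / minors_sq_sum k A"
  proof (rule mult_left_le_imp_le)
    show "(minor k A f g)\<^sup>2 * (\<Sum>r = 0..<n. \<Sum>c = 0..<d. (?E $$ (r, c))\<^sup>2)
        \<le> (minor k A f g)\<^sup>2 * (minors_sq_sum (Suc k) A / minors_sq_sum k A)"
      unfolding eq using le by (simp only: mult.commute)
    show "0 < (minor k A f g)\<^sup>2" using nz by simp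
  qed
  then have "(\<Sum>r = 0..<n. \<Sum>c = 0..<d. ((A - submatrix A UNIV W * the (mat_inverse ?X) *
      submatrix A S UNIV) $$ (r, c))\<^sup>2) \<le> minors_sq_sum (Suc k) A / minors_sq_sum k A"
    unfolding Y option.sel .
  then show ?thesis using pick(1-4) inv by blast
qed

section \<open>Euclidean norm and spectral norm\<close>

lemma vec_norm2_sq: "(vec_norm2 v)\<^sup>2 = (\<Sum>i = 0..<dim_vec v. (v $ i)\<^sup>2)"
  by (simp add: vec_norm2_def L2_set_def sum_nonneg lessThan_atLeast0)

lemma vec_norm2_sq_scalar_prod: "(vec_norm2 v)\<^sup>2 = v \<bullet> v"
  unfolding vec_norm2_sq by (simp add: scalar_prod_def power2_eq_square)

lemma vec_norm2_nonneg: "0 \<le> vec_norm2 v"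
  by (simp add: vec_norm2_def)

lemma zero_vec_if_norm_zero:
  assumes "v \<in> carrier_vec n" "(vec_norm2 v)\<^sup>2 = 0"
  shows "v = 0\<^sub>v n"
proof -
  have "\<forall>i \<in> {0..<n}. (v $ i)\<^sup>2 = 0"
    using assms unfolding vec_norm2_sq by (subst (asm) sum_nonneg_eq_0_iff) auto
  then show ?thesis using assms(1) by (intro eq_vecI) auto
qed

lemma vec_norm2_mult_le_frobenius:
  assumes A: "A \<in> carrier_mat n d" and v: "v \<in> carrier_vec d"
  shows "vec_norm2 (A *\<^sub>v v) \<le> sqrt (\<Sum>r = 0..<n. \<Sum>c = 0..<d. (A $$ (r, c))\<^sup>2) * vec_norm2 v"
proof -
  have "(vec_norm2 (A *\<^sub>v v))\<^sup>2 = (\<Sum>r = 0..<n. (\<Sum>c = 0..<d. A $$ (r, c) * v $ c)\<^sup>2)"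
    using A v by (simp add: vec_norm2_sq scalar_prod_def)
  also have "\<dots> \<le> (\<Sum>r = 0..<n. (\<Sum>c = 0..<d. (A $$ (r, c))\<^sup>2) * (\<Sum>c = 0..<d. (v $ c)\<^sup>2))"
    by (intro sum_mono Cauchy_Schwarz_ineq_sum)
  also have "\<dots> = (\<Sum>r = 0..<n. \<Sum>c = 0..<d. (A $$ (r, c))\<^sup>2) * (vec_norm2 v)\<^sup>2"
    using v by (simp add: vec_norm2_sq sum_distrib_right)
  finally have "sqrt ((vec_norm2 (A *\<^sub>v v))\<^sup>2) \<le>
      sqrt ((\<Sum>r = 0..<n. \<Sum>c = 0..<d. (A $$ (r, c))\<^sup>2) * (vec_norm2 v)\<^sup>2)"
    by (rule real_sqrt_le_mono)
  then show ?thesis by (simp add: real_sqrt_mult vec_norm2_nonneg)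
qed

lemma spectral_norm_le_frobenius:
  assumes A: "A \<in> carrier_mat n d"
  shows "spectral_norm A \<le> sqrt (\<Sum>r = 0..<n. \<Sum>c = 0..<d. (A $$ (r, c))\<^sup>2)"
  unfolding spectral_norm_def
proof (rule cSUP_least)
  have "0\<^sub>v d \<in> {v \<in> carrier_vec (dim_col A). vec_norm2 v \<le> 1}"
    using A by (simp add: vec_norm2_def L2_set_def)
  then show "{v \<in> carrier_vec (dim_col A). vec_norm2 v \<le> 1} \<noteq> {}" by blast
next
  fix v assume "v \<in> {v \<in> carrier_vec (dim_col A). vec_norm2 v \<le> 1}"
  then have v: "v \<in> carrier_vec d" "vec_norm2 v \<le> 1" using A by auto
  show "vec_norm2 (A *\<^sub>v v) \<le> sqrt (\<Sum>r = 0..<n. \<Sum>c = 0..<d. (A $$ (r, c))\<^sup>2)"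
    using vec_norm2_mult_le_frobenius[OF A v(1)] v(2)
      mult_left_mono[OF v(2), of "sqrt (\<Sum>r = 0..<n. \<Sum>c = 0..<d. (A $$ (r, c))\<^sup>2)"]
    by (simp add: sum_nonneg)
qed

text \<open>
  The Frobenius bound shows that the supremum in the definition of the norm is taken over a bounded set.
\<close>
lemma vec_norm2_le_spectral_norm:
  assumes A: "A \<in> carrier_mat n d" and v: "v \<in> carrier_vec d" "vec_norm2 v \<le> 1"
  shows "vec_norm2 (A *\<^sub>v v) \<le> spectral_norm A"
  unfolding spectral_norm_def
proof (rule cSUP_upper)
  show "v \<in> {v \<in> carrier_vec (dim_col A). vec_norm2 v \<le> 1}" using A v by simp
  show "bdd_above ((\<lambda>v. vec_norm2 (A *\<^sub>v v)) ` {v \<in> carrier_vec (dim_col A). vec_norm2 v \<le> 1})"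
  proof (rule bdd_aboveI2)
    fix v assume "v \<in> {v \<in> carrier_vec (dim_col A). vec_norm2 v \<le> 1}"
    then have v: "v \<in> carrier_vec d" "vec_norm2 v \<le> 1" using A by auto
    show "vec_norm2 (A *\<^sub>v v) \<le> sqrt (\<Sum>r = 0..<n. \<Sum>c = 0..<d. (A $$ (r, c))\<^sup>2)"
      using vec_norm2_mult_le_frobenius[OF A v(1)] v(2)
        mult_left_mono[OF v(2), of "sqrt (\<Sum>r = 0..<n. \<Sum>c = 0..<d. (A $$ (r, c))\<^sup>2)"]
      by (simp add: sum_nonneg)
  qed
qed

lemma spectral_norm_nonneg:
  assumes "A \<in> carrier_mat n d"
  shows "0 \<le> spectral_norm A"
proof -
  have "vec_norm2 (0\<^sub>v d :: real vec) = 0" by (simp add: vec_norm2_def L2_set_def)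
  then show ?thesis
    using vec_norm2_le_spectral_norm[OF assms, of "0\<^sub>v d"] vec_norm2_nonneg
    by (metis order_trans zero_carrier_vec zero_le_one)
qed

lemma vec_norm2_mult_le_spectral_norm:
  assumes A: "A \<in> carrier_mat n d" and v: "v \<in> carrier_vec d"
  shows "vec_norm2 (A *\<^sub>v v) \<le> spectral_norm A * vec_norm2 v"
proof (cases "vec_norm2 v = 0")
  case True
  then show ?thesis
    using vec_norm2_mult_le_frobenius[OF A v] by simp
next
  case False
  define s where "s = vec_norm2 v"
  have s: "s > 0" using False vec_norm2_nonneg[of v] by (simp add: s_def)
  have scale: "vec_norm2 (a \<cdot>\<^sub>v w) = a * vec_norm2 w" if "0 \<le> a" for a w
    using that by (simp add: vec_norm2_def L2_set_right_distrib cong: L2_set_cong_simp)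
  have "vec_norm2 (A *\<^sub>v ((1 / s) \<cdot>\<^sub>v v)) \<le> spectral_norm A"
    using A v s by (intro vec_norm2_le_spectral_norm) (auto simp: scale s_def)
  then show ?thesis
    using s A v by (simp add: mult_mat_vec[of _ n d] scale s_def[symmetric] field_simps)
qed

lemma vec_norm2_mult_diagonal_gram:
  assumes B: "B \<in> carrier_mat n m" and v: "v \<in> carrier_vec m"
    and D: "B\<^sup>T * B = mat m m (\<lambda>(a, b). if a = b then l a else 0)"
  shows "(vec_norm2 (B *\<^sub>v v))\<^sup>2 = (\<Sum>a = 0..<m. l a * (v $ a)\<^sup>2)"
proof -
  have Bv: "B *\<^sub>v v \<in> carrier_vec n" using B v by simp
  have "(vec_norm2 (B *\<^sub>v v))\<^sup>2 = (B\<^sup>T *\<^sub>v (B *\<^sub>v v)) \<bullet> v"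
    unfolding vec_norm2_sq_scalar_prod by (rule transpose_vec_mult_scalar[OF B v Bv, symmetric])
  also have "B\<^sup>T *\<^sub>v (B *\<^sub>v v) = (B\<^sup>T * B) *\<^sub>v v"
    using B v by (intro assoc_mult_mat_vec[symmetric]) auto
  also have "\<dots> = vec m (\<lambda>a. l a * v $ a)"
  proof (rule eq_vecI)
    fix a assume "a < dim_vec (vec m (\<lambda>a. l a * v $ a))"
    then have a: "a < m" by simp
    have "((B\<^sup>T * B) *\<^sub>v v) $ a = (\<Sum>b = 0..<m. (if a = b then l a else 0) * v $ b)"
      using a v unfolding D by (simp add: scalar_prod_def)
    also have "\<dots> = (\<Sum>b = 0..<m. if a = b then l a * v $ b else 0)"
      by (intro sum.cong) auto
    also have "\<dots> = l a * v $ a" using a by simp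
    finally show "((B\<^sup>T * B) *\<^sub>v v) $ a = vec m (\<lambda>a. l a * v $ a) $ a" using a by simp
  qed (use v in \<open>simp add: D\<close>)
  also have "\<dots> \<bullet> v = (\<Sum>a = 0..<m. l a * (v $ a)\<^sup>2)"
    using v by (simp add: scalar_prod_def power2_eq_square mult.assoc)
  finally show ?thesis .
qed

section \<open>Spectral theorem for real symmetric matrices\<close>

text \<open>
  The characteristic polynomial has a complex root \<open>\<mu>\<close>, with a complex eigenvector \<open>v\<close>. The number
  \<open>v\<^sup>* M v = \<mu> \<parallel>v\<parallel>\<^sup>2\<close> equals its own conjugate because \<open>M\<close> is real and symmetric, so \<open>\<mu>\<close> is real.
\<close>
lemma symmetric_real_eigenvalue_exists:
  fixes M :: "real mat"
  assumes M: "M \<in> carrier_mat d d" and sym: "M\<^sup>T = M" and d: "0 < d"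
  shows "\<exists>e. eigenvalue M e"
proof -
  let ?C = "map_mat complex_of_real M"
  have C: "?C \<in> carrier_mat d d" using M by simp
  obtain as where as: "char_poly ?C = (\<Prod>a \<leftarrow> as. [:- a, 1:])" "length as = d"
    using char_poly_factorized[OF C] by blast
  then obtain \<mu> as' where "as = \<mu> # as'" using d by (cases as) auto
  then have root: "poly (char_poly ?C) \<mu> = 0" using as by simp
  then obtain v where v: "v \<in> carrier_vec d" "v \<noteq> 0\<^sub>v d" "?C *\<^sub>v v = \<mu> \<cdot>\<^sub>v v"
    using eigenvalue_root_char_poly[OF C] C unfolding eigenvalue_def eigenvector_def by auto
  define N where "N = (\<Sum>a = 0..<d. (cmod (v $ a))\<^sup>2)"
  have "N \<noteq> 0"
  proof
    assume "N = 0"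
    then have "\<forall>a \<in> {0..<d}. (cmod (v $ a))\<^sup>2 = 0"
      unfolding N_def by (subst (asm) sum_nonneg_eq_0_iff) auto
    then have "v = 0\<^sub>v d" using v(1) by (intro eq_vecI) auto
    then show False using v by simp
  qed
  define s where "s = (\<Sum>a = 0..<d. \<Sum>b = 0..<d. cnj (v $ a) * complex_of_real (M $$ (a, b)) * v $ b)"
  have Msym: "M $$ (a, b) = M $$ (b, a)" if "a < d" "b < d" for a b
    using arg_cong[OF sym, of "\<lambda>X. X $$ (a, b)"] that M by simp
  have row: "(\<Sum>b = 0..<d. complex_of_real (M $$ (a, b)) * v $ b) = \<mu> * v $ a" if "a < d" for a
    using arg_cong[OF v(3), of "\<lambda>x. x $ a"] that M v(1) by (simp add: scalar_prod_def)
  have "s = (\<Sum>a = 0..<d. cnj (v $ a) * (\<Sum>b = 0..<d. complex_of_real (M $$ (a, b)) * v $ b))"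
    unfolding s_def by (simp add: sum_distrib_left mult.assoc)
  also have "\<dots> = (\<Sum>a = 0..<d. \<mu> * (v $ a * cnj (v $ a)))"
    by (intro sum.cong) (auto simp: row)
  also have "\<dots> = \<mu> * complex_of_real N"
    by (simp add: N_def sum_distrib_left complex_norm_square del: of_real_power)
  finally have s: "s = \<mu> * complex_of_real N" .
  have "cnj s = (\<Sum>a = 0..<d. \<Sum>b = 0..<d. v $ a * complex_of_real (M $$ (a, b)) * cnj (v $ b))"
    unfolding s_def by simp
  also have "\<dots> = (\<Sum>b = 0..<d. \<Sum>a = 0..<d. v $ a * complex_of_real (M $$ (a, b)) * cnj (v $ b))"
    by (rule sum.swap)
  also have "\<dots> = s"
    unfolding s_def by (intro sum.cong refl) (auto simp: Msym)
  finally have "cnj \<mu> = \<mu>" using s \<open>N \<noteq> 0\<close> by simp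
  then have "\<mu> = complex_of_real (Re \<mu>)" by (simp add: complex_eq_iff)
  then have "poly (char_poly M) (Re \<mu>) = 0"
    using root of_real_hom.char_poly_hom[OF M] by (metis of_real_eq_0_iff of_real_hom.poly_map_poly)
  then show ?thesis using eigenvalue_root_char_poly[OF M] by blast
qed

text \<open>
  The Householder reflection that maps the first unit vector to \<open>v\<close>.
\<close>
lemma orthogonal_mat_with_first_column:
  fixes v :: "real vec"
  assumes v: "v \<in> carrier_vec d" and unit: "v \<bullet> v = 1" and d: "0 < d"
  shows "\<exists>W \<in> carrier_mat d d. W\<^sup>T * W = 1\<^sub>m d \<and> col W 0 = v"
proof -
  let ?\<delta> = "\<lambda>i j. if i = j then 1 else 0 :: real"
  define w where "w i = v $ i - ?\<delta> i 0" for i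
  define q where "q = (\<Sum>i = 0..<d. (w i)\<^sup>2)"
  \<comment> \<open>If \<open>v\<close> is the first unit vector, then \<open>q = c = 0\<close> and \<open>W\<close> is the identity.\<close>
  define c where "c = 2 / q"
  define W where "W = mat d d (\<lambda>(i, j). ?\<delta> i j - c * w i * w j)"
  have W: "W \<in> carrier_mat d d" by (simp add: W_def)
  have vv: "(\<Sum>i = 0..<d. (v $ i)\<^sup>2) = 1"
    using unit v by (simp add: scalar_prod_def power2_eq_square)
  have "q = (\<Sum>i = 0..<d. (v $ i)\<^sup>2) - 2 * (\<Sum>i = 0..<d. v $ i * ?\<delta> i 0) + (\<Sum>i = 0..<d. ?\<delta> i 0)"
    unfolding q_def w_def sum_distrib_left sum_subtractf[symmetric] sum.distrib[symmetric]
    by (intro sum.cong refl) (auto simp: power2_eq_square algebra_simps)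
  also have "\<dots> = - 2 * w 0" using d by (simp add: vv w_def if_distrib cong: if_cong)
  finally have q: "q = - 2 * w 0" .
  have delta: "(\<Sum>l = 0..<d. x l * ?\<delta> l i) = x i" if "i < d" for x i
    using that by (simp add: if_distrib cong: if_cong)
  have sq: "W\<^sup>T * W = 1\<^sub>m d"
  proof (rule eq_matI)
    fix i j assume ij: "i < dim_row (1\<^sub>m d)" "j < dim_col (1\<^sub>m d)"
    have "(W\<^sup>T * W) $$ (i, j) = (\<Sum>l = 0..<d. (?\<delta> l i - c * w l * w i) * (?\<delta> l j - c * w l * w j))"
      using ij by (simp add: W_def scalar_prod_def)
    also have "\<dots> = (\<Sum>l = 0..<d. ?\<delta> l i * ?\<delta> l j) - c * w j * (\<Sum>l = 0..<d. w l * ?\<delta> l i)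
        - c * w i * (\<Sum>l = 0..<d. w l * ?\<delta> l j) + c * c * w i * w j * q"
      unfolding q_def sum_distrib_left sum_subtractf[symmetric] sum.distrib[symmetric]
      by (intro sum.cong refl) (auto simp: power2_eq_square algebra_simps)
    also have "(\<Sum>l = 0..<d. ?\<delta> l i * ?\<delta> l j) = ?\<delta> j i"
      using ij by (intro delta) simp
    also have "(\<Sum>l = 0..<d. w l * ?\<delta> l i) = w i" using ij by (intro delta) simp
    also have "(\<Sum>l = 0..<d. w l * ?\<delta> l j) = w j" using ij by (intro delta) simp
    also have "c * c * w i * w j * q = 2 * c * w i * w j"
      by (cases "q = 0") (simp_all add: c_def)
    finally show "(W\<^sup>T * W) $$ (i, j) = 1\<^sub>m d $$ (i, j)" using ij by auto
  qed (auto simp: W_def)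
  have "col W 0 = v"
  proof (rule eq_vecI)
    fix i assume "i < dim_vec v"
    then have i: "i < d" using v by simp
    have "- c * w 0 * w i = w i"
    proof (cases "q = 0")
      case True
      then have "\<forall>i \<in> {0..<d}. (w i)\<^sup>2 = 0"
        unfolding q_def by (subst (asm) sum_nonneg_eq_0_iff) auto
      then show ?thesis using i by simp
    next
      case False
      then show ?thesis using q by (simp add: c_def)
    qed
    then show "col W 0 $ i = v $ i" using i d by (simp add: W_def w_def mult_ac)
  qed (use v in \<open>simp add: W_def\<close>)
  then show ?thesis using W sq by blast
qed

lemma congruence_index:
  fixes U M :: "real mat"
  assumes "U \<in> carrier_mat d m" "M \<in> carrier_mat d d" "i < m" "j < m"
  shows "(U\<^sup>T * M * U) $$ (i, j) = col U i \<bullet> (M *\<^sub>v col U j)"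
proof -
  have "U\<^sup>T * M * U = U\<^sup>T * (M * U)"
    using assms by (intro assoc_mult_mat[where ?n\<^sub>3.0 = d]) auto
  then show ?thesis using assms by (simp add: mult_mat_vec_def)
qed

text \<open>
  Deflation: in an orthonormal basis that starts with a unit eigenvector, the first column of \<open>M\<close>
  is a multiple of the first unit vector. By symmetry the first row is too, so that \<open>M\<close> splits
  off a \<open>1 \<times> 1\<close> block and the induction hypothesis applies to the rest.
\<close>
lemma real_spectral_theorem:
  fixes M :: "real mat"
  assumes "M \<in> carrier_mat d d" "M\<^sup>T = M"
  shows "\<exists>U l. U \<in> carrier_mat d d \<and> U\<^sup>T * U = 1\<^sub>m d \<and>
    U\<^sup>T * M * U = mat d d (\<lambda>(a, b). if a = b then l a else 0)"
  using assms
proof (induction d arbitrary: M)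
  case 0
  then show ?case by (intro exI[of _ "1\<^sub>m 0"] exI conjI eq_matI) auto
next
  case (Suc d)
  note M = Suc.prems(1)
  obtain e x where x: "x \<in> carrier_vec (Suc d)" "x \<noteq> 0\<^sub>v (Suc d)" "M *\<^sub>v x = e \<cdot>\<^sub>v x"
    using symmetric_real_eigenvalue_exists[OF Suc.prems] M
    unfolding eigenvalue_def eigenvector_def by auto
  obtain i where i: "i < Suc d" "x $ i \<noteq> 0"
    using x(1,2) by (metis carrier_vecD eq_vecI index_zero_vec)
  have "0 < (\<Sum>i = 0..<Suc d. x $ i * x $ i)"
    using i by (intro sum_pos2[of _ i]) (auto simp: zero_less_mult_iff)
  then have xx: "0 < x \<bullet> x" using x(1) by (simp add: scalar_prod_def)
  define v where "v = (1 / sqrt (x \<bullet> x)) \<cdot>\<^sub>v x"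
  have v: "v \<in> carrier_vec (Suc d)" using x by (simp add: v_def)
  have vv: "v \<bullet> v = 1" using x(1) xx by (simp add: v_def)
  have Mv: "M *\<^sub>v v = e \<cdot>\<^sub>v v"
    using M x by (simp add: v_def mult_mat_vec[of _ "Suc d" "Suc d"] smult_smult_assoc mult.commute)
  obtain W where W: "W \<in> carrier_mat (Suc d) (Suc d)" "W\<^sup>T * W = 1\<^sub>m (Suc d)" "col W 0 = v"
    using orthogonal_mat_with_first_column[OF v vv] by auto
  define N where "N = W\<^sup>T * M * W"
  have N: "N \<in> carrier_mat (Suc d) (Suc d)" using W M by (simp add: N_def)
  have "N\<^sup>T = N" unfolding N_def
    using W M Suc.prems(2) by (simp add: transpose_mult[of _ "Suc d" "Suc d" _ "Suc d"] assoc_mult_mat[of _ "Suc d" "Suc d" _ "Suc d" _ "Suc d"])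
  then have Nsym: "N $$ (i, j) = N $$ (j, i)" if "i < Suc d" "j < Suc d" for i j
    using that N by (metis carrier_matD index_transpose_mat(1))
  have col0: "N $$ (i, 0) = (if i = 0 then e else 0)" if "i < Suc d" for i
  proof -
    have "N $$ (i, 0) = col W i \<bullet> (M *\<^sub>v v)"
      using congruence_index[OF W(1) M that] W(3) by (simp add: N_def)
    also have "\<dots> = e * (col W i \<bullet> col W 0)"
      using W v that by (simp add: Mv)
    also have "col W i \<bullet> col W 0 = (W\<^sup>T * W) $$ (i, 0)" using W(1) that by simp
    finally show ?thesis using that by (simp add: W(2))
  qed
  have row0: "N $$ (0, j) = (if j = 0 then e else 0)" if "j < Suc d" for j
    using col0[OF that] Nsym[of 0 j] that by simp
  define M3 where "M3 = mat d d (\<lambda>(i, j). N $$ (Suc i, Suc j))"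
  define E where "E = mat 1 1 (\<lambda>_. e)"
  have M3: "M3 \<in> carrier_mat d d" and E: "E \<in> carrier_mat 1 1" by (simp_all add: M3_def E_def)
  have sym3: "M3\<^sup>T = M3"
  proof (rule eq_matI)
    fix i j assume "i < dim_row M3" "j < dim_col M3"
    then show "M3\<^sup>T $$ (i, j) = M3 $$ (i, j)"
      using Nsym[of "Suc i" "Suc j"] by (simp add: M3_def)
  qed (auto simp: M3_def)
  have block: "N = four_block_mat E (0\<^sub>m 1 d) (0\<^sub>m d 1) M3"
  proof (rule eq_matI)
    fix i j assume ij: "i < dim_row (four_block_mat E (0\<^sub>m 1 d) (0\<^sub>m d 1) M3)"
      "j < dim_col (four_block_mat E (0\<^sub>m 1 d) (0\<^sub>m d 1) M3)"
    then show "N $$ (i, j) = four_block_mat E (0\<^sub>m 1 d) (0\<^sub>m d 1) M3 $$ (i, j)"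
      using col0[of i] row0[of j] by (cases i; cases j) (simp_all add: E_def M3_def)
  qed (use N in \<open>auto simp: E_def M3_def\<close>)
  obtain U3 l3 where U3: "U3 \<in> carrier_mat d d" "U3\<^sup>T * U3 = 1\<^sub>m d"
    and diag: "U3\<^sup>T * M3 * U3 = mat d d (\<lambda>(a, b). if a = b then l3 a else 0)"
    using Suc.IH[OF M3 sym3] by blast
  define V where "V = four_block_mat (1\<^sub>m 1) (0\<^sub>m 1 d) (0\<^sub>m d 1) U3"
  have V: "V \<in> carrier_mat (Suc d) (Suc d)" using four_block_carrier_mat[of "1\<^sub>m 1" 1 1 U3 d d] U3 by (simp add: V_def)
  have VT: "V\<^sup>T = four_block_mat (1\<^sub>m 1) (0\<^sub>m 1 d) (0\<^sub>m d 1) (U3\<^sup>T)"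
    unfolding V_def using U3 by (subst transpose_four_block_mat[of _ 1 1 _ d _ d]) auto
  have VV: "V\<^sup>T * V = 1\<^sub>m (Suc d)"
    unfolding VT unfolding V_def using U3
    by (subst mult_four_block_mat[of _ 1 1 _ d _ d _ _ 1 _ d]) auto
  have "V\<^sup>T * N * V = four_block_mat E (0\<^sub>m 1 d) (0\<^sub>m d 1) (U3\<^sup>T * M3 * U3)"
    unfolding VT block unfolding V_def using U3 E M3
    by (subst mult_four_block_mat[of _ 1 1 _ d _ d _ _ 1 _ d], auto)+
  also have "\<dots> = mat (Suc d) (Suc d) (\<lambda>(a, b). if a = b then case a of 0 \<Rightarrow> e | Suc i \<Rightarrow> l3 i else 0)"
    unfolding diag by (rule eq_matI) (auto simp: E_def split: nat.splits)
  finally have D: "V\<^sup>T * N * V = \<dots>" .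
  have UT: "(W * V)\<^sup>T = V\<^sup>T * W\<^sup>T" using W V by (simp add: transpose_mult)
  note assoc = assoc_mult_mat[of _ "Suc d" "Suc d" _ "Suc d" _ "Suc d"]
  have "(W * V)\<^sup>T * (W * V) = V\<^sup>T * ((W\<^sup>T * W) * V)"
    unfolding UT using W(1) V by (simp add: assoc)
  also have "\<dots> = 1\<^sub>m (Suc d)" unfolding W(2) using V VV by simp
  finally have "(W * V)\<^sup>T * (W * V) = 1\<^sub>m (Suc d)" .
  moreover have "(W * V)\<^sup>T * M * (W * V) = V\<^sup>T * N * V"
    unfolding UT N_def using W(1) V M by (simp add: assoc)
  moreover have "W * V \<in> carrier_mat (Suc d) (Suc d)" using W(1) V by simp
  ultimately show ?case
    unfolding D by (intro exI[of _ "W * V"] exI[of _ "\<lambda>a. case a of 0 \<Rightarrow> e | Suc i \<Rightarrow> l3 i"]) simp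
qed

text \<open>
  The diagonal entries of any orthogonal diagonalisation are the roots of the characteristic
  polynomial with multiplicity; permuting the columns of the basis puts them into decreasing order.
\<close>
lemma sorted_eigenbasis:
  fixes M :: "real mat"
  assumes M: "M \<in> carrier_mat d d" and sym: "M\<^sup>T = M"
  shows "\<exists>U. U \<in> carrier_mat d d \<and> U\<^sup>T * U = 1\<^sub>m d \<and> U * U\<^sup>T = 1\<^sub>m d \<and>
      U\<^sup>T * M * U = mat d d (\<lambda>(a, b). if a = b then nth_largest_eigenvalue M (Suc a) else 0)"
    and "i \<le> j \<Longrightarrow> j < d \<Longrightarrow> nth_largest_eigenvalue M (Suc j) \<le> nth_largest_eigenvalue M (Suc i)"
proof -
  obtain V l where V: "V \<in> carrier_mat d d" "V\<^sup>T * V = 1\<^sub>m d"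
    and D: "V\<^sup>T * M * V = mat d d (\<lambda>(a, b). if a = b then l a else 0)"
    using real_spectral_theorem[OF assms] by blast
  let ?D = "mat d d (\<lambda>(a, b). if a = b then l a else 0)"
  have VV: "V * V\<^sup>T = 1\<^sub>m d"
    using mat_mult_left_right_inverse[OF _ V(1,2)] V(1) by simp
  have "similar_mat_wit ?D M V\<^sup>T V"
    using V VV M D by (intro similar_mat_witI[of _ _ d]) auto
  then have "char_poly M = char_poly ?D"
    using char_poly_similar[of ?D M] unfolding similar_mat_def by metis
  also have "\<dots> = (\<Prod>a \<leftarrow> diag_mat ?D. [:- a, 1:])"
    by (rule char_poly_upper_triangular[of _ d]) (auto simp: upper_triangular_def)
  also have "diag_mat ?D = map l [0..<d]" by (auto simp: diag_mat_def)
  finally have cp: "char_poly M = (\<Prod>a \<leftarrow> map l [0..<d]. [:- a, 1:])" .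
  have lin: "proots (\<Prod>a \<leftarrow> xs. [:- a, 1:]) = mset xs" for xs :: "real list"
  proof (induction xs)
    case (Cons a xs)
    have "(\<Prod>a \<leftarrow> xs. [:- a, 1:]) \<noteq> 0" by (auto simp: prod_list_zero_iff)
    then have "proots ([:- a, 1:] * (\<Prod>a \<leftarrow> xs. [:- a, 1:])) = proots [:- a, 1:] + proots (\<Prod>a \<leftarrow> xs. [:- a, 1:])"
      by (intro proots_mult) auto
    then show ?case using Cons.IH by simp
  qed simp
  let ?xs = "rev (sorted_list_of_multiset (proots (char_poly M)))"
  have mset: "mset ?xs = mset (map l [0..<d])"
    unfolding cp lin by simp
  then have len: "length ?xs = d" by (metis length_map length_upt minus_nat.diff_0 mset_eq_length)
  have lam: "nth_largest_eigenvalue M (Suc a) = ?xs ! a" for a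
    by (simp add: nth_largest_eigenvalue_def)
  have "sorted (rev ?xs)" by simp
  then show "nth_largest_eigenvalue M (Suc j) \<le> nth_largest_eigenvalue M (Suc i)" if "i \<le> j" "j < d"
    using that len unfolding lam by (metis sorted_rev_nth_mono)
  obtain p where p: "p permutes {..<d}" "permute_list p (map l [0..<d]) = ?xs"
    using mset_eq_permutation[OF mset] by auto
  have pd: "p i < d" if "i < d" for i using permutes_in_image[OF p(1), of i] that by simp
  have xs: "?xs ! i = l (p i)" if "i < d" for i
    unfolding p(2)[symmetric] using that pd p(1) by (simp add: permute_list_nth)
  define U where "U = mat d d (\<lambda>(i, j). V $$ (i, p j))"
  have U: "U \<in> carrier_mat d d" by (simp add: U_def)
  have colU: "col U j = col V (p j)" if "j < d" for j
    using that pd V(1) by (intro eq_vecI) (auto simp: U_def)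
  have peq: "p i = p j \<longleftrightarrow> i = j" for i j using permutes_inj[OF p(1)] by (auto simp: inj_def)
  have "(U\<^sup>T * U) = 1\<^sub>m d"
  proof (rule eq_matI)
    fix i j assume ij: "i < dim_row (1\<^sub>m d)" "j < dim_col (1\<^sub>m d)"
    then have "(U\<^sup>T * U) $$ (i, j) = (V\<^sup>T * V) $$ (p i, p j)"
      using U V(1) pd by (simp add: colU)
    then show "(U\<^sup>T * U) $$ (i, j) = 1\<^sub>m d $$ (i, j)"
      using ij pd by (simp add: V(2) peq)
  qed (use U in auto)
  moreover have "U * U\<^sup>T = 1\<^sub>m d"
    using mat_mult_left_right_inverse[OF _ U calculation] U by simp
  moreover have "U\<^sup>T * M * U = mat d d (\<lambda>(a, b). if a = b then nth_largest_eigenvalue M (Suc a) else 0)"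
  proof (rule eq_matI)
    fix i j assume "i < dim_row (mat d d (\<lambda>(a, b). if a = b then nth_largest_eigenvalue M (Suc a) else 0))"
      "j < dim_col (mat d d (\<lambda>(a, b). if a = b then nth_largest_eigenvalue M (Suc a) else 0))"
    then have ij: "i < d" "j < d" by auto
    have "(U\<^sup>T * M * U) $$ (i, j) = (V\<^sup>T * M * V) $$ (p i, p j)"
      using ij pd by (simp only: congruence_index[OF U M] congruence_index[OF V(1) M] colU)
    also have "\<dots> = (if i = j then l (p i) else 0)" using ij pd by (simp add: D peq)
    finally show "(U\<^sup>T * M * U) $$ (i, j) =
        mat d d (\<lambda>(a, b). if a = b then nth_largest_eigenvalue M (Suc a) else 0) $$ (i, j)"
      using ij by (simp add: lam xs)
  qed (use U in auto)
  ultimately show "\<exists>U. U \<in> carrier_mat d d \<and> U\<^sup>T * U = 1\<^sub>m d \<and> U * U\<^sup>T = 1\<^sub>m d \<and>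
      U\<^sup>T * M * U = mat d d (\<lambda>(a, b). if a = b then nth_largest_eigenvalue M (Suc a) else 0)"
    using U by blast
qed

section \<open>Squared singular values and approximation of low rank\<close>

text \<open>
  Indices start at \<open>0\<close>, so that they agree with column indices.
\<close>
definition sq_singular_value :: "real mat \<Rightarrow> nat \<Rightarrow> real" where
  "sq_singular_value A i = nth_largest_eigenvalue (A\<^sup>T * A) (Suc i)"

lemma gram_eigenbasis:
  assumes A: "A \<in> carrier_mat n d"
  shows "\<exists>U. U \<in> carrier_mat d d \<and> U\<^sup>T * U = 1\<^sub>m d \<and> U * U\<^sup>T = 1\<^sub>m d \<and>
    (A * U)\<^sup>T * (A * U) = mat d d (\<lambda>(a, b). if a = b then sq_singular_value A a else 0)"
proof -
  let ?M = "A\<^sup>T * A"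
  have M: "?M \<in> carrier_mat d d" using A by simp
  have "?M\<^sup>T = ?M" using A by (simp add: transpose_mult[of _ d n _ d])
  then obtain U where U: "U \<in> carrier_mat d d" "U\<^sup>T * U = 1\<^sub>m d" "U * U\<^sup>T = 1\<^sub>m d"
    and D: "U\<^sup>T * ?M * U = mat d d (\<lambda>(a, b). if a = b then sq_singular_value A a else 0)"
    using sorted_eigenbasis(1)[OF M] unfolding sq_singular_value_def by blast
  have "(A * U)\<^sup>T * (A * U) = U\<^sup>T * A\<^sup>T * (A * U)"
    using A U by (simp add: transpose_mult)
  also have "\<dots> = U\<^sup>T * A\<^sup>T * A * U"
    using A U by (intro assoc_mult_mat[where ?n\<^sub>2.0 = n, symmetric]) auto
  also have "U\<^sup>T * A\<^sup>T * A = U\<^sup>T * ?M"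
    using A U by (intro assoc_mult_mat) auto
  finally show ?thesis using U D by metis
qed

lemma gram_leading_columns:
  fixes B :: "real mat"
  assumes B: "B \<in> carrier_mat n d" and m: "m \<le> d"
  defines "V \<equiv> mat n m (\<lambda>(i, j). B $$ (i, j))"
  shows "V\<^sup>T * V = mat m m (\<lambda>(i, j). (B\<^sup>T * B) $$ (i, j))"
proof (rule eq_matI)
  have colV: "col V j = col B j" if "j < m" for j
    using that m B by (intro eq_vecI) (auto simp: V_def)
  fix i j assume "i < dim_row (mat m m (\<lambda>(i, j). (B\<^sup>T * B) $$ (i, j)))"
    "j < dim_col (mat m m (\<lambda>(i, j). (B\<^sup>T * B) $$ (i, j)))"
  then have ij: "i < m" "j < m" by auto
  then have "(V\<^sup>T * V) $$ (i, j) = col V i \<bullet> col V j" by (simp add: V_def)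
  also have "\<dots> = (B\<^sup>T * B) $$ (i, j)" using ij B m by (simp add: colV)
  finally show "(V\<^sup>T * V) $$ (i, j) = mat m m (\<lambda>(i, j). (B\<^sup>T * B) $$ (i, j)) $$ (i, j)"
    using ij by simp
qed (auto simp: V_def)

text \<open>
  A map of rank at most \<open>k\<close> has a nontrivial kernel on each space of dimension \<open>k + 1\<close>. All its minors of
  size \<open>k + 1\<close> vanish, and so do those of \<open>C U\<close>, because the sums of their squares agree. The columns of
  \<open>C V\<close> are among those of \<open>C U\<close>; hence the Gram determinant of \<open>C V\<close> is zero, and a kernel vector of
  the Gram matrix is one of \<open>C V\<close>.
\<close>
lemma low_rank_kernel_vector:
  fixes C :: "real mat"
  assumes C: "C \<in> carrier_mat n d" and rank: "vec_space.rank n C \<le> k"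
    and U: "U \<in> carrier_mat d d" "U * U\<^sup>T = 1\<^sub>m d" and k: "k < d"
  defines "V \<equiv> mat d (Suc k) (\<lambda>(i, j). U $$ (i, j))"
  shows "\<exists>v \<in> carrier_vec (Suc k). v \<noteq> 0\<^sub>v (Suc k) \<and> C *\<^sub>v (V *\<^sub>v v) = 0\<^sub>v n"
proof -
  have V: "V \<in> carrier_mat d (Suc k)" by (simp add: V_def)
  have CV: "C * V \<in> carrier_mat n (Suc k)" using C V by simp
  have CU: "C * U \<in> carrier_mat n d" using C U by simp
  \<comment> \<open>The first \<open>k + 1\<close> columns, as a tuple that takes the default value elsewhere.\<close>
  define g where "g = restrict (\<lambda>i :: nat. i) {0..<Suc k}"
  have g: "g \<in> tuples (Suc k) d" using k by (auto simp: g_def)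
  have "minors_sq_sum (Suc k) C = 0"
    unfolding minors_sq_sum_def using C rank
    by (intro sum.neutral ballI) (auto intro!: minor_zero_if_rank_less[OF C])
  then have "minors_sq_sum (Suc k) (C * U) = 0"
    using minors_sq_sum_orthogonal[OF C U] by simp
  then have "(\<Sum>f \<in> tuples (Suc k) n. \<Sum>g \<in> tuples (Suc k) d. (minor (Suc k) (C * U) f g)\<^sup>2) = 0"
    unfolding minors_sq_sum_def carrier_matD[OF CU] .
  then have "\<forall>f \<in> tuples (Suc k) n. (\<Sum>g \<in> tuples (Suc k) d. (minor (Suc k) (C * U) f g)\<^sup>2) = 0"
    by (subst (asm) sum_nonneg_eq_0_iff) (auto intro: finite_PiE sum_nonneg)
  then have zero: "minor (Suc k) (C * U) f g = 0" if "f \<in> tuples (Suc k) n" for f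
    using that g by (subst (asm) sum_nonneg_eq_0_iff) (auto intro: finite_PiE)
  have "minor (Suc k) (C * V) f (\<lambda>i. i) = minor (Suc k) (C * U) f g" if "f \<in> tuples (Suc k) n" for f
    unfolding minor_def
  proof (intro arg_cong[of _ _ det] eq_matI, goal_cases)
    case (1 i j)
    then have "f i < n" "j < Suc k" "g j = j" using that by (auto simp: PiE_iff g_def)
    then show ?case using 1 C V U k
      by (auto simp: scalar_prod_def V_def intro!: sum.cong)
  qed auto
  then have "(\<Sum>f \<in> tuples (Suc k) n. (minor (Suc k) (C * V) f (\<lambda>i. i))\<^sup>2) = 0"
    using zero by simp
  then have "minor (Suc k) ((C * V)\<^sup>T * (C * V)) (\<lambda>i. i) (\<lambda>i. i) = 0"
    using sum_minor_sq_rows[OF CV, of "Suc k" "\<lambda>i. i"] by simp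
  moreover have G: "(C * V)\<^sup>T * (C * V) \<in> carrier_mat (Suc k) (Suc k)" using CV by simp
  moreover have "mat (Suc k) (Suc k) (\<lambda>(i, j). X $$ (i, j)) = X" if "X \<in> carrier_mat (Suc k) (Suc k)"
    for X :: "real mat" using that by (intro eq_matI) auto
  ultimately have "det ((C * V)\<^sup>T * (C * V)) = 0"
    unfolding minor_def by metis
  then obtain v where v: "v \<in> carrier_vec (Suc k)" "v \<noteq> 0\<^sub>v (Suc k)"
    and Gv: "((C * V)\<^sup>T * (C * V)) *\<^sub>v v = 0\<^sub>v (Suc k)"
    using det_0_iff_vec_prod_zero_field[OF G] by blast
  have CVv: "(C * V) *\<^sub>v v \<in> carrier_vec n" using CV v by simp
  have "(vec_norm2 ((C * V) *\<^sub>v v))\<^sup>2 = ((C * V)\<^sup>T *\<^sub>v ((C * V) *\<^sub>v v)) \<bullet> v"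
    unfolding vec_norm2_sq_scalar_prod by (rule transpose_vec_mult_scalar[OF CV v(1) CVv, symmetric])
  also have "(C * V)\<^sup>T *\<^sub>v ((C * V) *\<^sub>v v) = 0\<^sub>v (Suc k)"
    unfolding Gv[symmetric] using CV v by (intro assoc_mult_mat_vec[symmetric]) auto
  also have "0\<^sub>v (Suc k) \<bullet> v = 0" using v by simp
  finally have "(C * V) *\<^sub>v v = 0\<^sub>v n" by (rule zero_vec_if_norm_zero[OF CVv])
  then have "C *\<^sub>v (V *\<^sub>v v) = 0\<^sub>v n"
    using assoc_mult_mat_vec[OF C V v(1)] by simp
  then show ?thesis using v by blast
qed

text \<open>
  The lower bound of the Eckart--Young theorem: on the span of the first \<open>k + 1\<close> eigenvectors \<open>A\<close>
  stretches every vector by a factor of at least \<open>\<surd>(sq_singular_value A k)\<close>, and \<open>C\<close>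
  annihilates a nonzero vector of that space.
\<close>
lemma eigenvalue_le_low_rank_error:
  assumes A: "A \<in> carrier_mat n d" and C: "C \<in> carrier_mat n d"
    and rank: "vec_space.rank n C \<le> k" and k: "k < d"
  shows "sq_singular_value A k \<le> (spectral_norm (A - C))\<^sup>2"
proof -
  let ?l = "sq_singular_value A"
  obtain U where U: "U \<in> carrier_mat d d" "U\<^sup>T * U = 1\<^sub>m d" "U * U\<^sup>T = 1\<^sub>m d"
    and D: "(A * U)\<^sup>T * (A * U) = mat d d (\<lambda>(a, b). if a = b then ?l a else 0)"
    using gram_eigenbasis[OF A] by blast
  define V where "V = mat d (Suc k) (\<lambda>(i, j). U $$ (i, j))"
  have V: "V \<in> carrier_mat d (Suc k)" by (simp add: V_def)
  have kd: "Suc k \<le> d" using k by simp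
  have V1: "V\<^sup>T * V = mat (Suc k) (Suc k) (\<lambda>(a, b). if a = b then 1 else 0)"
    using gram_leading_columns[OF U(1) kd] k unfolding V_def[symmetric] U(2)
    by (auto intro!: eq_matI)
  have AU: "A * U \<in> carrier_mat n d" using A U by simp
  have "A * V = mat n (Suc k) (\<lambda>(i, j). (A * U) $$ (i, j))"
    using A U(1) k by (intro eq_matI) (auto simp: V_def scalar_prod_def intro!: sum.cong)
  then have AV: "(A * V)\<^sup>T * (A * V) = mat (Suc k) (Suc k) (\<lambda>(a, b). if a = b then ?l a else 0)"
    using gram_leading_columns[OF AU kd] k unfolding D
    by (auto intro!: eq_matI)
  obtain v where v: "v \<in> carrier_vec (Suc k)" "v \<noteq> 0\<^sub>v (Suc k)" "C *\<^sub>v (V *\<^sub>v v) = 0\<^sub>v n"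
    using low_rank_kernel_vector[OF C rank U(1,3) k] unfolding V_def by blast
  let ?x = "V *\<^sub>v v"
  have x: "?x \<in> carrier_vec d" using V v by simp
  have Mx: "(A - C) *\<^sub>v ?x = A *\<^sub>v ?x"
    using A C x v(3) by (simp add: minus_mult_distrib_mat_vec)
  have nx: "(vec_norm2 ?x)\<^sup>2 = (\<Sum>a = 0..<Suc k. (v $ a)\<^sup>2)"
    using vec_norm2_mult_diagonal_gram[OF V v(1) V1] by simp
  have "(vec_norm2 (A *\<^sub>v ?x))\<^sup>2 = (\<Sum>a = 0..<Suc k. ?l a * (v $ a)\<^sup>2)"
    using vec_norm2_mult_diagonal_gram[OF _ v(1) AV, of n] A V assoc_mult_mat_vec[OF A V v(1)] by simp
  also have "\<dots> \<ge> (\<Sum>a = 0..<Suc k. ?l k * (v $ a)\<^sup>2)"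
  proof (intro sum_mono mult_right_mono)
    fix a assume "a \<in> {0..<Suc k}"
    have "A\<^sup>T * A \<in> carrier_mat d d" "(A\<^sup>T * A)\<^sup>T = A\<^sup>T * A"
      using A by (auto simp: transpose_mult[of _ d n _ d])
    then show "?l k \<le> ?l a"
      unfolding sq_singular_value_def using \<open>a \<in> {0..<Suc k}\<close> k by (intro sorted_eigenbasis(2)) auto
  qed auto
  finally have "?l k * (vec_norm2 ?x)\<^sup>2 \<le> (vec_norm2 ((A - C) *\<^sub>v ?x))\<^sup>2"
    unfolding nx Mx sum_distrib_left .
  also have "\<dots> \<le> (spectral_norm (A - C) * vec_norm2 ?x)\<^sup>2"
    using A C x by (intro power_mono vec_norm2_mult_le_spectral_norm[of _ n d] vec_norm2_nonneg) auto
  finally have le: "?l k * (vec_norm2 ?x)\<^sup>2 \<le> (spectral_norm (A - C))\<^sup>2 * (vec_norm2 ?x)\<^sup>2"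
    by (simp add: power_mult_distrib)
  have "0 < (vec_norm2 ?x)\<^sup>2"
  proof -
    obtain i where i: "i < Suc k" "v $ i \<noteq> 0"
      using v(1,2) by (metis carrier_vecD eq_vecI index_zero_vec)
    then show ?thesis unfolding nx by (intro sum_pos2[of _ i]) auto
  qed
  with le show ?thesis by (simp add: mult_le_cancel_right)
qed

lemma rank_sum_of_products_le:
  fixes b u :: "nat \<Rightarrow> nat \<Rightarrow> real"
  shows "vec_space.rank n (mat n d (\<lambda>(r, c). \<Sum>j = 0..<k. b r j * u c j)) \<le> k"
proof (induction k)
  case 0
  have "mat n d (\<lambda>(r, c). \<Sum>j = 0..<0. b r j * u c j) = 0\<^sub>m n d" by (intro eq_matI) auto
  then show ?case by (metis vec_space.rank_0I order_refl)
next
  case (Suc k)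
  interpret vec_space "TYPE(real)" n .
  let ?X = "mat n d (\<lambda>(r, c). \<Sum>j = 0..<k. b r j * u c j)"
  let ?Y = "mat n d (\<lambda>(r, c). b r k * u c k)"
  have "mat n d (\<lambda>(r, c). \<Sum>j = 0..<Suc k. b r j * u c j) = ?X + ?Y" by (intro eq_matI) auto
  moreover have "rank (?X + ?Y) \<le> rank ?X + rank ?Y" by (rule rank_subadditive) auto
  moreover have "rank ?Y \<le> 1" by (rule rank_le_1_product_entries[of _ d "\<lambda>r. b r k" "\<lambda>c. u c k"]) auto
  ultimately show ?case using Suc.IH by simp
qed

text \<open>
  The eigenvalues are the squared norms of the columns of \<open>B = A U\<close>. The one of index \<open>j\<close> vanishes for
  \<open>j \<ge> rank A\<close> by \<open>eigenvalue_le_low_rank_error\<close> with \<open>C = A\<close>. Conversely, if it vanishes, then so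
  do all columns of \<open>B\<close> from \<open>j\<close> on, and \<open>A = B U\<^sup>T\<close> is a sum of \<open>j\<close> matrices of rank at most one.
\<close>
lemma gram_eigenvalues:
  assumes A: "A \<in> carrier_mat n d"
  defines "l \<equiv> sq_singular_value A"
  shows "i \<le> j \<Longrightarrow> j < d \<Longrightarrow> l j \<le> l i"
    and "j < d \<Longrightarrow> 0 \<le> l j"
    and "j < d \<Longrightarrow> l j \<le> (spectral_norm A)\<^sup>2"
    and "vec_space.rank n A \<le> j \<Longrightarrow> j < d \<Longrightarrow> l j = 0"
    and "j < vec_space.rank n A \<Longrightarrow> 0 < l j"
    and "minors_sq_sum m A = fact m * inj_tuple_sum m {0..<d} l"
proof -
  obtain U where U: "U \<in> carrier_mat d d" "U\<^sup>T * U = 1\<^sub>m d" "U * U\<^sup>T = 1\<^sub>m d"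
    and D: "(A * U)\<^sup>T * (A * U) = mat d d (\<lambda>(a, b). if a = b then l a else 0)"
    using gram_eigenbasis[OF A] unfolding l_def by blast
  have UT: "U\<^sup>T * U = mat d d (\<lambda>(a, b). if a = b then 1 else 0)"
    unfolding U(2) one_mat_def ..
  let ?B = "A * U"
  have B: "?B \<in> carrier_mat n d" using A U by simp
  show mono: "l j \<le> l i" if "i \<le> j" "j < d" for i j
  proof -
    have "A\<^sup>T * A \<in> carrier_mat d d" "(A\<^sup>T * A)\<^sup>T = A\<^sup>T * A"
      using A by (auto simp: transpose_mult[of _ d n _ d])
    then show ?thesis unfolding l_def sq_singular_value_def using that by (intro sorted_eigenbasis(2)) auto
  qed
  have unit: "(\<Sum>a = 0..<d. x a * (unit_vec d j $ a)\<^sup>2) = x j" if "j < d" for j and x :: "nat \<Rightarrow> real"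
  proof -
    have "(\<Sum>a = 0..<d. x a * (unit_vec d j $ a)\<^sup>2) = (\<Sum>a = 0..<d. if a = j then x a else 0)"
      using that by (intro sum.cong) auto
    then show ?thesis using that by simp
  qed
  have norm: "(vec_norm2 (?B *\<^sub>v unit_vec d j))\<^sup>2 = l j" "(vec_norm2 (U *\<^sub>v unit_vec d j))\<^sup>2 = 1" if "j < d" for j
    using vec_norm2_mult_diagonal_gram[OF B _ D, of "unit_vec d j"] unit[OF that, of l]
      vec_norm2_mult_diagonal_gram[OF U(1) _ UT, of "unit_vec d j"] unit[OF that, of "\<lambda>_. 1"] by auto
  show nonneg: "0 \<le> l j" if "j < d" for j using norm(1)[OF that] by (metis zero_le_power2)
  show "l j \<le> (spectral_norm A)\<^sup>2" if "j < d" for j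
  proof -
    have "vec_norm2 (U *\<^sub>v unit_vec d j) = 1"
      using norm(2)[OF that] vec_norm2_nonneg[of "U *\<^sub>v unit_vec d j"] by (simp add: power2_eq_1_iff)
    then have "vec_norm2 (A *\<^sub>v (U *\<^sub>v unit_vec d j)) \<le> spectral_norm A"
      using A U by (intro vec_norm2_le_spectral_norm) auto
    moreover have "A *\<^sub>v (U *\<^sub>v unit_vec d j) = ?B *\<^sub>v unit_vec d j"
      using assoc_mult_mat_vec[OF A U(1), of "unit_vec d j"] by simp
    ultimately show ?thesis
      using norm(1)[OF that] vec_norm2_nonneg by (metis power_mono)
  qed
  show "l j = 0" if "vec_space.rank n A \<le> j" "j < d" for j
  proof -
    have "A - A = 0\<^sub>m n d" using A by (intro eq_matI) auto
    then have "spectral_norm (A - A) \<le> 0"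
      using spectral_norm_le_frobenius[of "0\<^sub>m n d" n d] by simp
    moreover have "0 \<le> spectral_norm (A - A)" using A by (intro spectral_norm_nonneg[of _ n d]) auto
    ultimately have "spectral_norm (A - A) = 0" by simp
    then have "l j \<le> 0"
      using eigenvalue_le_low_rank_error[OF A A that] by (simp add: l_def)
    then show ?thesis using nonneg[OF that(2)] by simp
  qed
  show "0 < l j" if j: "j < vec_space.rank n A" for j
  proof (rule ccontr)
    have jd: "j < d" using j vec_space.rank_le_nc[OF A] by simp
    assume "\<not> 0 < l j"
    then have lzero: "l a = 0" if "j \<le> a" "a < d" for a
      using mono[OF that] nonneg[OF that(2)] by simp
    have Bzero: "?B $$ (r, a) = 0" if "r < n" "j \<le> a" "a < d" for r a
    proof -
      have "?B *\<^sub>v unit_vec d a = col ?B a" using B that by (intro eq_vecI) (auto simp del: index_mult_mat)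
      then have "(vec_norm2 (col ?B a))\<^sup>2 = 0" using norm(1)[OF that(3)] lzero that by simp
      then have "col ?B a = 0\<^sub>v n"
        using B that by (intro zero_vec_if_norm_zero) auto
      then have "col ?B a $ r = 0" using that by simp
      then show ?thesis using B that by (simp del: index_mult_mat)
    qed
    have "?B * U\<^sup>T = A * (U * U\<^sup>T)" using A U(1) by (intro assoc_mult_mat) auto
    then have AB: "A = ?B * U\<^sup>T" using A U(3) by simp
    have "A = mat n d (\<lambda>(r, c). \<Sum>a = 0..<j. ?B $$ (r, a) * U $$ (c, a))"
    proof (rule eq_matI)
      fix r c assume "r < dim_row (mat n d (\<lambda>(r, c). \<Sum>a = 0..<j. ?B $$ (r, a) * U $$ (c, a)))"
        "c < dim_col (mat n d (\<lambda>(r, c). \<Sum>a = 0..<j. ?B $$ (r, a) * U $$ (c, a)))"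
      then have rc: "r < n" "c < d" by auto
      have "(X * U\<^sup>T) $$ (r, c) = (\<Sum>a = 0..<d. X $$ (r, a) * U $$ (c, a))"
        if "X \<in> carrier_mat n d" for X
        using that rc U(1) by (simp add: scalar_prod_def)
      from this[OF B] have "A $$ (r, c) = (\<Sum>a = 0..<d. ?B $$ (r, a) * U $$ (c, a))"
        using arg_cong[OF AB, of "\<lambda>X. X $$ (r, c)"] by (rule trans[rotated])
      also have "\<dots> = (\<Sum>a = 0..<j. ?B $$ (r, a) * U $$ (c, a))"
        using jd rc Bzero by (intro sum.mono_neutral_right) (auto simp del: index_mult_mat)
      finally show "A $$ (r, c) = mat n d (\<lambda>(r, c). \<Sum>a = 0..<j. ?B $$ (r, a) * U $$ (c, a)) $$ (r, c)"
        using rc by simp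
    qed (use A in auto)
    then have "vec_space.rank n A =
        vec_space.rank n (mat n d (\<lambda>(r, c). \<Sum>a = 0..<j. ?B $$ (r, a) * U $$ (c, a)))"
      by (rule arg_cong)
    also have "\<dots> \<le> j" by (rule rank_sum_of_products_le)
    finally show False using j by simp
  qed
  show "minors_sq_sum m A = fact m * inj_tuple_sum m {0..<d} l"
    using minors_sq_sum_diagonal_gram[OF B D] minors_sq_sum_orthogonal[OF A U(1,3)] by simp
qed

section \<open>The approximation bound\<close>

lemma minors_sq_sum_ratio:
  assumes A: "A \<in> carrier_mat n d" and k: "k < vec_space.rank n A"
  defines "l \<equiv> sq_singular_value A"
  shows "0 < minors_sq_sum k A"
    and "minors_sq_sum (Suc k) A / minors_sq_sum k A \<le>
      (real k + 1)\<^sup>2 * (real (vec_space.rank n A) - real k) / (1 + (\<Sum>i = 0..<k. l k / l i)) * l k"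
proof -
  define t where "t = vec_space.rank n A"
  note eigen = gram_eigenvalues[OF A, folded l_def t_def]
  have td: "t \<le> d" unfolding t_def using vec_space.rank_le_nc[OF A] .
  have kt: "k < t" using k by (simp add: t_def)
  have "inj_tuple_sum j {0..<d} l = inj_tuple_sum j {0..<t} l" for j
    using td eigen(4) by (intro inj_tuple_sum_support) auto
  then have P: "minors_sq_sum j A = fact j * inj_tuple_sum j {0..<t} l" for j
    using eigen(6) by simp
  have pos: "0 < inj_tuple_sum k {0..<t} l"
    using kt eigen(5) by (intro inj_tuple_sum_pos) auto
  then show "0 < minors_sq_sum k A" by (simp add: P)
  have s: "0 \<le> (\<Sum>i = 0..<k. l k / l i)"
    using kt eigen(5) by (intro sum_nonneg divide_nonneg_nonneg) (auto intro: less_imp_le)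
  have "(1 + (\<Sum>i \<in> {0..<k}. l k / l i)) * inj_tuple_sum (Suc k) {0..<t} l
      \<le> real (Suc k) * (real (card {0..<t}) - real k) * l k * inj_tuple_sum k {0..<t} l"
    using kt td eigen(1,5) by (intro inj_tuple_sum_ratio) auto
  then have "inj_tuple_sum (Suc k) {0..<t} l / inj_tuple_sum k {0..<t} l
      \<le> (real k + 1) * (real t - real k) * l k / (1 + (\<Sum>i = 0..<k. l k / l i))"
    using pos s by (simp add: field_simps)
  then have "(real k + 1) * (inj_tuple_sum (Suc k) {0..<t} l / inj_tuple_sum k {0..<t} l)
      \<le> (real k + 1) * ((real k + 1) * (real t - real k) * l k / (1 + (\<Sum>i = 0..<k. l k / l i)))"
    by (intro mult_left_mono) auto
  moreover have "minors_sq_sum (Suc k) A / minors_sq_sum k A =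
      (real k + 1) * (inj_tuple_sum (Suc k) {0..<t} l / inj_tuple_sum k {0..<t} l)"
    unfolding P by (simp add: add.commute)
  ultimately show "minors_sq_sum (Suc k) A / minors_sq_sum k A \<le>
      (real k + 1)\<^sup>2 * (real (vec_space.rank n A) - real k) / (1 + (\<Sum>i = 0..<k. l k / l i)) * l k"
    unfolding t_def[symmetric] by (simp add: power2_eq_square mult_ac)
qed

text \<open>
  With \<open>r = 1 - \<surd>\<alpha>\<close> one has \<open>1 - \<alpha> = r (2 - r) \<ge> r\<close>, so \<open>r (k + 1) \<le> 1 + k r \<le> 1 + s\<close>. This
  uses up one factor \<open>r (k + 1)\<close>; the other is at most \<open>k + 1\<close>, and \<open>(k + 1) (t - k) \<le> t (t - k + 1)\<close>.
\<close>
lemma selection_constant_bound: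
  fixes s \<alpha> :: real and k t :: nat
  assumes \<alpha>: "0 < \<alpha>" "\<alpha> < 1" and k: "k < t" and s: "real k * (1 - \<alpha>) \<le> s"
  shows "(real k + 1)\<^sup>2 * (real t - real k) / (1 + s)
    \<le> (real t - real k + 1) * real t / (1 - sqrt \<alpha>)\<^sup>2"
proof -
  define r where "r = 1 - sqrt \<alpha>"
  have r: "0 < r" "r \<le> 1" using \<alpha> by (auto simp: r_def)
  have "1 - \<alpha> = r * (2 - r)"
    using \<alpha> by (simp add: r_def algebra_simps)
  also have "\<dots> \<ge> r" using r mult_left_mono[of 1 "2 - r" r] by simp
  finally have "real k * r \<le> s" using s mult_left_mono[of r "1 - \<alpha>" "real k"] by simp
  then have a: "r * (real k + 1) \<le> 1 + s" using r by (simp add: algebra_simps)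
  have spos: "0 < 1 + s" using a r by (smt (verit) mult_pos_pos of_nat_0_le_iff)
  have "(r * (real k + 1)) * (r * (real k + 1)) \<le> (1 + s) * (1 * (real k + 1))"
    using a r spos by (intro mult_mono) auto
  then have "(r * (real k + 1))\<^sup>2 * (real t - real k) \<le> (1 + s) * (real k + 1) * (real t - real k)"
    unfolding power2_eq_square using k by (intro mult_right_mono) auto
  also have "\<dots> \<le> (1 + s) * (real t * (real t - real k + 1))"
    unfolding mult.assoc using k spos by (intro mult_left_mono mult_mono) auto
  finally have "(real k + 1)\<^sup>2 * (real t - real k) * r\<^sup>2 \<le> (real t - real k + 1) * real t * (1 + s)"
    by (simp add: power_mult_distrib mult_ac)
  then show ?thesis
    unfolding r_def[symmetric] using r spos by (simp add: frac_le_eq divide_le_eq pos_le_divide_eq mult_ac field_simps)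
qed

text \<open>
  Let \<open>y\<close> be the mean of the numbers \<open>1 / l i\<close>, \<open>i < k\<close>. Then \<open>1 < y < 1 / l k\<close>; both inequalities
  are strict because \<open>l 0\<close> and \<open>l (k - 1)\<close> differ. This locates \<open>\<alpha>\<close>, and \<open>1 - \<alpha>\<close> is the fraction
  \<open>(y - 1) / (1 / l k - 1)\<close>, which is at most \<open>y / (1 / l k)\<close>: subtracting the same amount from numerator and
  denominator decreases a fraction below \<open>1\<close>.
\<close>
lemma harmonic_defect_bounds:
  fixes l :: "nat \<Rightarrow> real" and k :: nat
  assumes k: "0 < k" and mu: "0 < l k" and le1: "\<And>i. i \<le> k \<Longrightarrow> l i \<le> 1"
    and mono: "\<And>i. i \<le> k \<Longrightarrow> l k \<le> l i" and strict: "l (k - 1) < l 0"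
  defines "\<alpha> \<equiv> (1 / l k - (1 / real k) * (\<Sum>i = 0..<k. 1 / l i)) / (1 / l k - 1)"
  shows "0 < \<alpha>" "\<alpha> < 1" "real k * (1 - \<alpha>) \<le> (\<Sum>i = 0..<k. l k / l i)"
proof -
  define y where "y = (1 / real k) * (\<Sum>i = 0..<k. 1 / l i)"
  have pos: "0 < l i" if "i \<le> k" for i using mono[OF that] mu by simp
  have lk: "l k < l 0" "l k < 1" "l (k - 1) < 1"
    using strict mono[of "k - 1"] le1[of 0] k by auto
  have "(\<Sum>i = 0..<k. 1 / l i) < (\<Sum>i = 0..<k. 1 / l k)"
  proof (rule sum_strict_mono_ex1)
    show "\<forall>i \<in> {0..<k}. 1 / l i \<le> 1 / l k" using mono mu by (auto intro!: divide_left_mono simp: pos)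
    show "\<exists>i \<in> {0..<k}. 1 / l i < 1 / l k" using k lk mu by (intro bexI[of _ 0] divide_strict_left_mono) auto
  qed auto
  then have y1: "y < 1 / l k" using k by (simp add: y_def field_simps)
  have "(\<Sum>i = 0..<k. 1) < (\<Sum>i = 0..<k. 1 / l i)"
  proof (rule sum_strict_mono_ex1)
    show "\<forall>i \<in> {0..<k}. 1 \<le> 1 / l i" using le1 pos by auto
    show "\<exists>i \<in> {0..<k}. 1 < 1 / l i" using k lk pos[of "k - 1"] by (intro bexI[of _ "k - 1"]) auto
  qed auto
  then have y2: "1 < y" using k by (simp add: y_def field_simps)
  have U: "1 < 1 / l k" using lk mu by simp
  have \<alpha>: "\<alpha> = (1 / l k - y) / (1 / l k - 1)" by (simp add: \<alpha>_def y_def)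
  show "0 < \<alpha>" "\<alpha> < 1" unfolding \<alpha> using y1 y2 U by (auto simp: divide_less_eq)
  have "1 - \<alpha> = ((1 / l k - 1) - (1 / l k - y)) / (1 / l k - 1)"
    using U unfolding \<alpha> by (subst (2) diff_divide_distrib) auto
  also have "\<dots> = (y - 1) / (1 / l k - 1)" by simp
  also have "\<dots> \<le> l k * y"
  proof -
    have "l k * y < 1" using y1 mu by (simp add: field_simps)
    then have "y - 1 \<le> l k * y * (1 / l k - 1)" using mu by (simp add: field_simps)
    then show ?thesis using U by (simp add: pos_divide_le_eq)
  qed
  finally have "real k * (1 - \<alpha>) \<le> real k * (l k * y)" by (intro mult_left_mono) auto
  also have "\<dots> = (\<Sum>i = 0..<k. l k / l i)" using k by (simp add: y_def sum_distrib_left)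
  finally show "real k * (1 - \<alpha>) \<le> (\<Sum>i = 0..<k. l k / l i)" .
qed

theorem theorem1p2:
  fixes A Ak :: "real mat" and n d t k :: nat
    and lam :: "nat \<Rightarrow> real" and \<alpha> :: real
  assumes "A \<in> carrier_mat n d"
    and "vec_space.rank n A = t"
    and "spectral_norm A \<le> 1"
    and "2 \<le> k" and "k \<le> t - 1"
    and "lam = nth_largest_eigenvalue (A\<^sup>T * A)"
    and "lam 1 > lam k"
    and "best_rank_approx k A Ak"
    and "\<alpha> = (1 / lam (k + 1) - (1 / real k) * (\<Sum>i = 1..k. 1 / lam i)) / (1 / lam (k + 1) - 1)"
  shows "\<alpha> \<in> {0<..<1} \<and>
    (\<exists>S W. S \<subseteq> {0..<n} \<and> card S = k \<and> W \<subseteq> {0..<d} \<and> card W = k \<and>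
      invertible_mat (submatrix A S W) \<and>
      (spectral_norm (A - submatrix A UNIV W * the (mat_inverse (submatrix A S W)) * submatrix A S UNIV))\<^sup>2
        \<le> (real t - real k + 1) * real t / (1 - sqrt \<alpha>)\<^sup>2 * (spectral_norm (A - Ak))\<^sup>2)"
proof -
  note A = assms(1)
  define l where "l = sq_singular_value A"
  note eigen = gram_eigenvalues[OF A, folded l_def, unfolded assms(2)]
  have lam: "lam (Suc a) = l a" for a by (simp add: assms(6) l_def sq_singular_value_def)
  have k: "0 < k" "k < t" using assms(4,5) by auto
  have td: "t \<le> d" using vec_space.rank_le_nc[OF A] assms(2) by simp
  have le1: "l i \<le> 1" if "i \<le> k" for i
  proof -
    have "l i \<le> (spectral_norm A)\<^sup>2" using that k td by (intro eigen(3)) auto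
    also have "\<dots> \<le> 1" using assms(3) spectral_norm_nonneg[OF A] by (simp add: power_le_one)
    finally show ?thesis .
  qed
  have "(\<Sum>i = 1..k. 1 / lam i) = (\<Sum>i = 0..<k. 1 / l i)"
    by (rule sum.reindex_bij_witness[of _ Suc "\<lambda>i. i - 1"]) (auto simp: lam[symmetric])
  then have \<alpha>: "\<alpha> = (1 / l k - (1 / real k) * (\<Sum>i = 0..<k. 1 / l i)) / (1 / l k - 1)"
    using assms(9) by (simp add: lam)
  \<comment> \<open>The hypothesis \<open>lam 1 > lam k\<close> counts from \<open>1\<close>, and \<open>l\<close> counts from \<open>0\<close>.\<close>
  have strict: "l (k - 1) < l 0" using assms(7) k lam[of 0] lam[of "k - 1"] by simp
  have mono: "l k \<le> l i" if "i \<le> k" for i using that k td by (intro eigen(1)) auto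
  have bounds: "0 < \<alpha>" "\<alpha> < 1" "real k * (1 - \<alpha>) \<le> (\<Sum>i = 0..<k. l k / l i)"
    using harmonic_defect_bounds[of k l, OF k(1) eigen(5)[OF k(2)] le1 mono strict] unfolding \<alpha> by auto
  have approx: "l k \<le> (spectral_norm (A - Ak))\<^sup>2"
    using assms(8) A k td unfolding best_rank_approx_def l_def
    by (intro eigenvalue_le_low_rank_error[of _ n d]) auto
  have kr: "k < vec_space.rank n A" using k assms(2) by simp
  note ratio = minors_sq_sum_ratio[OF A kr, folded l_def, unfolded assms(2)]
  obtain S W where SW: "S \<subseteq> {0..<n}" "card S = k" "W \<subseteq> {0..<d}" "card W = k"
      "invertible_mat (submatrix A S W)"
    and F: "(\<Sum>r = 0..<n. \<Sum>c = 0..<d. ((A - submatrix A UNIV W * the (mat_inverse (submatrix A S W)) *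
        submatrix A S UNIV) $$ (r, c))\<^sup>2) \<le> minors_sq_sum (Suc k) A / minors_sq_sum k A"
    using exists_cross_approximation[OF A ratio(1)] by blast
  let ?E = "A - submatrix A UNIV W * the (mat_inverse (submatrix A S W)) * submatrix A S UNIV"
  have "{j. j < d \<and> j \<in> UNIV} = {0..<d}" "{i. i < n \<and> i \<in> UNIV} = {0..<n}" by auto
  then have E: "?E \<in> carrier_mat n d"
    using A by (intro carrier_matI) (simp_all add: dim_submatrix)
  have "(spectral_norm ?E)\<^sup>2 \<le> (sqrt (\<Sum>r = 0..<n. \<Sum>c = 0..<d. (?E $$ (r, c))\<^sup>2))\<^sup>2"
    by (intro power_mono spectral_norm_le_frobenius[OF E] spectral_norm_nonneg[OF E])
  also have "\<dots> = (\<Sum>r = 0..<n. \<Sum>c = 0..<d. (?E $$ (r, c))\<^sup>2)"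
    by (simp add: sum_nonneg del: index_minus_mat)
  also have "\<dots> \<le> minors_sq_sum (Suc k) A / minors_sq_sum k A" by (rule F)
  also have "\<dots> \<le> (real k + 1)\<^sup>2 * (real t - real k) / (1 + (\<Sum>i = 0..<k. l k / l i)) * l k"
    by (rule ratio(2))
  also have "\<dots> \<le> (real t - real k + 1) * real t / (1 - sqrt \<alpha>)\<^sup>2 * (spectral_norm (A - Ak))\<^sup>2"
    using selection_constant_bound[OF bounds(1,2) k(2) bounds(3)] approx k eigen(5)[OF k(2)]
    by (intro mult_mono) auto
  finally show ?thesis using bounds(1,2) SW by (intro conjI exI[of _ S] exI[of _ W]) auto
qed

end
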